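(* There exists an absolute constant $c>0$ such that for all positive integers $k\le n$ and all real $\rho$ with $0<\rho\le 1$, $$\inf_{\hat W}\ \sup_{W}\ \mathbb{E}_{G\sim G_n(W)}\left[\delta_2(\hat W(G),W)\right]\ \ge\ c\cdot\min\left(\rho,\ \sqrt{\frac{\rho k^2}{n^2}}\right),$$ where the infimum is over all estimators $\hat W:\mathcal{G}_n\to\mathcal{W}$ and the supremum is over all $k$-block, $\rho$-bounded graphons $W$.
   Context: A graphon is a symmetric measurable function $W:[0,1]^2\to[0,1]$ (symmetric: $W(x,y)=W(y,x)$ for all $x,y$). $\mathcal{W}$ denotes the set of all graphons. A graphon is $\rho$-bounded if it takes values in $[0,\rho]$. A graphon $W$ is a $k$-block graphon if there is a partition of $[0,1]$ into $k$ measurable sets $I_1,\dots,I_k$ such that $W$ is constant on $I_i\times I_j$ for all $i,j$. $\mathcal{G}_n$ denotes the set of (simple undirected) graphs on $n$ nodes. For a graphon $W$, $G_n(W)$ is the random graph on $n$ nodes obtained by drawing $\ell_1,\dots,\ell_n$ independently and uniformly from $[0,1]$ and then, conditionally on these, connecting each pair of nodes $i,j$ independently with probability $W(\ell_i,\ell_j)$; the values $\ell_i$ are not part of the graph. An estimator is a function $\hat W:\mathcal{G}_n\to\mathcal{W}$ (it may depend on $n,k,\rho$). For graphons $W,W'$, $\delta_2(W,W')=\inf_{\phi}\|W_\phi-W'\|_2$, where $\phi$ ranges over all measurable measure-preserving maps $[0,1]\to[0,1]$ (Lebesgue measure), $W_\phi(x,y)=W(\phi(x),\phi(y))$, and $\|\cdot\|_2$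 is the $L_2$ norm on $[0,1]^2$. *)

theory Defs
  imports "HOL-Probability.Probability" "HOL-Library.Disjoint_Sets"
begin

text \<open>
  Functions on the unit square are total functions on the reals of which only the values on
  the unit square matter. ``Measurable'' means Lebesgue measurable throughout.
\<close>

type_synonym kernel = "real \<Rightarrow> real \<Rightarrow> real"

definition graphon :: "kernel \<Rightarrow> bool" where
  "graphon W \<longleftrightarrow>
     case_prod W \<in> borel_measurable (lebesgue_on ({0..1} \<times> {0..1})) \<and>
     (\<forall>x\<in>{0..1}. \<forall>y\<in>{0..1}. W x y = W y x) \<and>
     (\<forall>x\<in>{0..1}. \<forall>y\<in>{0..1}. 0 \<le> W x y \<and> W x y \<le> 1)"

definition bounded_graphon :: "real \<Rightarrow> kernel \<Rightarrow> bool" where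
  "bounded_graphon \<rho> W \<longleftrightarrow>
     graphon W \<and> (\<forall>x\<in>{0..1}. \<forall>y\<in>{0..1}. 0 \<le> W x y \<and> W x y \<le> \<rho>)"

text \<open>
  The parts of \<^term>\<open>partition_on\<close> are nonempty. Allowing empty parts would give the same graphons,
  since an infinite part can always be split further into measurable parts.
\<close>

definition block_graphon :: "nat \<Rightarrow> kernel \<Rightarrow> bool" where
  "block_graphon k W \<longleftrightarrow>
     graphon W \<and>
     (\<exists>P. partition_on {0..1} P \<and> finite P \<and> card P = k \<and> P \<subseteq> sets lebesgue \<and>
        (\<forall>I\<in>P. \<forall>J\<in>P. \<exists>c. \<forall>x\<in>I. \<forall>y\<in>J. W x y = c))"

definition measure_preserving_maps :: "(real \<Rightarrow> real) set" where
  "measure_preserving_maps =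
     {\<phi> \<in> lebesgue_on {0..1} \<rightarrow>\<^sub>M lebesgue_on {0..1}.
        distr (lebesgue_on {0..1}) (lebesgue_on {0..1}) \<phi> = lebesgue_on {0..1}}"

definition pullback :: "kernel \<Rightarrow> (real \<Rightarrow> real) \<Rightarrow> kernel" where
  "pullback W \<phi> = (\<lambda>x y. W (\<phi> x) (\<phi> y))"

definition l2_norm :: "kernel \<Rightarrow> real" where
  "l2_norm U = sqrt (LINT (x, y)|lebesgue_on ({0..1} \<times> {0..1}). (U x y)\<^sup>2)"

definition delta2 :: "kernel \<Rightarrow> kernel \<Rightarrow> real" where
  "delta2 W W' =
     (INF \<phi>\<in>measure_preserving_maps. l2_norm (\<lambda>x y. pullback W \<phi> x y - W' x y))"

text \<open>
  A simple undirected graph on the nodes \<open>0, \<dots>, n - 1\<close> is represented by its set of edges,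
  an edge being a two-element set of nodes.
\<close>

type_synonym graph = "nat set set"

definition graphs :: "nat \<Rightarrow> graph set" where
  "graphs n = Pow {e. e \<subseteq> {..<n} \<and> card e = 2}"

definition node_pairs :: "nat \<Rightarrow> (nat \<times> nat) set" where
  "node_pairs n = {(i, j). i < j \<and> j < n}"

text \<open>
  The labels are distributed according to Lebesgue measure on the \<open>n\<close>-dimensional unit cube.
  The completion is needed because \<open>W (l i) (l j)\<close>, for a Lebesgue measurable \<open>W\<close>, need not be
  measurable for the product of the Lebesgue sigma-algebras.
\<close>

definition label_space :: "nat \<Rightarrow> (nat \<Rightarrow> real) measure" where
  "label_space n = completion (\<Pi>\<^sub>M i\<in>{..<n}. lebesgue_on {0..1})"

definition graph_given_labels :: "nat \<Rightarrow> kernel \<Rightarrow> (nat \<Rightarrow> real) \<Rightarrow> graph pmf" where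
  "graph_given_labels n W l =
     map_pmf (\<lambda>b. {{i, j} | i j. (i, j) \<in> node_pairs n \<and> b (i, j)})
       (Pi_pmf (node_pairs n) False (\<lambda>(i, j). bernoulli_pmf (W (l i) (l j))))"

definition random_graph :: "nat \<Rightarrow> kernel \<Rightarrow> graph measure" where
  "random_graph n W = label_space n \<bind> (\<lambda>l. measure_pmf (graph_given_labels n W l))"

definition estimators :: "nat \<Rightarrow> (graph \<Rightarrow> kernel) set" where
  "estimators n = graphs n \<rightarrow> {W. graphon W}"

end

theory Submission
  imports Defs "HOL-Real_Asymp.Real_Asymp"
begin

text \<open>
  Consider block graphons on \<open>k\<close> intervals of equal length whose levels are \<open>\<rho> / 2 + \<epsilon>\<close> or
  \<open>\<rho> / 2 - \<epsilon>\<close> according to a symmetric sign pattern, with \<open>\<epsilon>\<close> a small multiple of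
  \<open>min \<rho> (sqrt (\<rho> * k\<^sup>2 / n\<^sup>2))\<close>. The pattern is chosen uniformly from a family \<open>S\<close>, and the maximal risk
  of an estimator is bounded below by its average risk over \<open>S\<close>. Two facts make the average risk
  large.

  The first is geometric. Suppose that the estimate is within \<open>\<epsilon> / 4\<close> of two of these graphons, with
  respect to possibly different measure preserving maps. The densities of the blocks pushed forward along
  the two maps refine each other and yield a coupling of the two sets of blocks under which the
  patterns rarely disagree (\<open>coupling_triangle\<close>). The expected disagreement is bilinear in two copies
  of the coupling, so the coupling can be rounded to two maps between the blocks (\<open>round_coupling\<close>):
  after relabelling rows and columns the patterns agree in most entries. For fixed relabellings this
  confines a pattern to a Hamming ball, an exponentially small part of the \<open>2 ^ (k * (k + 1) / 2)\<close>
  symmetric patterns, and there are only \<open>k ^ (2 * k)\<close> pairs of relabellings. Hence for large \<open>k\<close> the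
  patterns close to any one estimate form a fraction \<open>\<beta>\<close> of order at most \<open>exp (- \<kappa> * k\<^sup>2)\<close>
  (\<open>separated_patterns\<close>). For bounded \<open>k\<close> two constant patterns do the same with \<open>\<beta> = 1/2\<close>.

  The second is statistical. Given the labels, the edges are independent with probabilities within
  \<open>\<epsilon>\<close> of \<open>\<rho> / 2\<close>, so the second moment of the likelihood ratio against the homogeneous model with edge
  probability \<open>\<rho> / 2\<close> is at most \<open>exp (2 * n\<^sup>2 * \<epsilon>\<^sup>2 / \<rho>)\<close>, and by the choice of \<open>\<epsilon>\<close> at most
  \<open>exp (\<kappa> * k\<^sup>2)\<close>. Under the homogeneous model the graph says nothing about the pattern, and the
  estimate is close to the truth with probability at most \<open>\<beta>\<close>; by the Cauchy-Schwarz inequality this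
  probability is at most \<open>sqrt (\<beta> * exp (\<kappa> * k\<^sup>2)) \<le> sqrt (2/3)\<close> under the true model
  (\<open>identification_probability_bound\<close>). So the error is at least \<open>\<epsilon> / 4\<close> with probability bounded away
  from zero. This holds for every value of the labels, hence on average.
\<close>

section \<open>Lebesgue measure on the unit square\<close>

abbreviation unit_leb :: "real measure" where
  "unit_leb \<equiv> lebesgue_on {0..1}"

abbreviation square_leb :: "(real \<times> real) measure" where
  "square_leb \<equiv> lebesgue_on ({0..1} \<times> {0..1})"

lemma square_borel: "{0..1::real} \<times> {0..1::real} \<in> sets borel"
  by (intro borel_closed closed_Times) auto

lemma prob_space_unit_leb: "prob_space unit_leb"
  by (rule prob_spaceI) (simp add: emeasure_restrict_space space_restrict_space)

interpretation unit_leb: prob_space unit_leb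
  by (rule prob_space_unit_leb)

interpretation unit_pair: pair_prob_space unit_leb unit_leb ..

lemma complete_measure_lebesgue_on:
  assumes "S \<in> sets lebesgue"
  shows "complete_measure (lebesgue_on S)"
proof
  fix A B assume A: "A \<subseteq> B" "B \<in> null_sets (lebesgue_on S)"
  then show "A \<in> sets (lebesgue_on S)"
    using assms null_sets_restrict_space[OF assms]
    by (metis completion.complete2 null_setsD2 subset_trans)
qed

lemma complete_square_leb: "complete_measure square_leb"
  by (rule complete_measure_lebesgue_on) (use square_borel in auto)

text \<open>
  A Lebesgue set is a Borel set up to a subset of a Borel null set, so a Borel measurable map out of
  a complete measure space is measurable for the Lebesgue sigma-algebra as soon as preimages of null
  sets are null. Every substitution into a graphon below (a measure preserving map in both
  coordinates, or a pair of labels) is of this kind.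
\<close>

lemma nonsingular_measurable_lebesgue:
  fixes T :: "'a \<Rightarrow> 'b::euclidean_space"
  assumes "complete_measure M" "T \<in> M \<rightarrow>\<^sub>M borel" "absolutely_continuous lborel (distr M lborel T)"
  shows "T \<in> M \<rightarrow>\<^sub>M lebesgue"
  using assms complete_measure.measurable_completion2[of M T lborel]
  by (simp add: absolutely_continuous_def)

lemma nonsingular_AE:
  fixes T :: "'a \<Rightarrow> 'b::euclidean_space"
  assumes "T \<in> M \<rightarrow>\<^sub>M borel" "absolutely_continuous lborel (distr M lborel T)"
    and "AE z in lborel. P z"
  shows "AE x in M. P (T x)"
proof (rule AE_distrD[where f=T and M'=lborel])
  show "T \<in> M \<rightarrow>\<^sub>M lborel" using assms by simp
  show "AE z in distr M lborel T. P z"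
    using assms by (intro absolutely_continuous_AE[OF _ assms(2)]) auto
qed

lemma measurable_fst_snd_square_borel:
  "fst \<in> square_leb \<rightarrow>\<^sub>M (borel::real measure)" "snd \<in> square_leb \<rightarrow>\<^sub>M (borel::real measure)"
  by (auto intro!: measurable_restrict_space1 measurable_completion simp: borel_prod[symmetric] lborel_prod[symmetric])

lemma absolutely_continuous_fst_snd:
  "absolutely_continuous lborel (distr square_leb lborel fst)"
  "absolutely_continuous lborel (distr square_leb lborel snd)"
proof -
  note 1 = measurable_fst_snd_square_borel
  {
    fix N :: "real set" assume N: "N \<in> null_sets lborel"
    have "N \<times> UNIV \<in> null_sets (lborel \<Otimes>\<^sub>M (lborel :: real measure))"
         "UNIV \<times> N \<in> null_sets ((lborel :: real measure) \<Otimes>\<^sub>M lborel)"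
      using N by (auto simp: null_sets_def lborel.emeasure_pair_measure_Times)
    then have *: "N \<times> UNIV \<in> null_sets (lebesgue :: (real\<times>real) measure)"
                 "UNIV \<times> N \<in> null_sets (lebesgue :: (real\<times>real) measure)"
      by (auto simp: lborel_prod intro: null_sets_completionI)
    have S: "{0..1::real} \<times> {0..1::real} \<in> sets lebesgue" using square_borel by auto
    have "fst -` N \<inter> space square_leb \<in> null_sets square_leb"
      unfolding null_sets_restrict_space[OF S]
      by (auto simp: space_restrict_space null_sets_restrict_space[OF S]
           intro!: completion.complete2[OF _ *(1)])
    moreover have "snd -` N \<inter> space square_leb \<in> null_sets square_leb"
      unfolding null_sets_restrict_space[OF S]
      by (auto simp: space_restrict_space null_sets_restrict_space[OF S]
           intro!: completion.complete2[OF _ *(2)])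
    ultimately
    have "N \<in> null_sets (distr square_leb lborel fst)" "N \<in> null_sets (distr square_leb lborel snd)"
      using 1 N by (auto simp: null_sets_distr_iff)
  }
  then show "absolutely_continuous lborel (distr square_leb lborel fst)"
    "absolutely_continuous lborel (distr square_leb lborel snd)"
    by (auto simp: absolutely_continuous_def)
qed

lemma measurable_fst_snd_square:
  "fst \<in> square_leb \<rightarrow>\<^sub>M unit_leb" "snd \<in> square_leb \<rightarrow>\<^sub>M unit_leb"
proof -
  note 1 = measurable_fst_snd_square_borel
  show "fst \<in> square_leb \<rightarrow>\<^sub>M unit_leb" "snd \<in> square_leb \<rightarrow>\<^sub>M unit_leb"
    using nonsingular_measurable_lebesgue[OF complete_square_leb 1(1) absolutely_continuous_fst_snd(1)]
     nonsingular_measurable_lebesgue[OF complete_square_leb 1(2) absolutely_continuous_fst_snd(2)]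
    by (auto intro!: measurable_restrict_space2 simp: space_restrict_space)
qed

lemma measurable_id_square_pair: "(\<lambda>z. z) \<in> square_leb \<rightarrow>\<^sub>M unit_leb \<Otimes>\<^sub>M unit_leb"
  using measurable_Pair[OF measurable_fst_snd_square] by simp

lemma emeasure_square_borel_Times:
  fixes A B :: "real set"
  assumes "A \<in> sets borel" "B \<in> sets borel" "A \<subseteq> {0..1}" "B \<subseteq> {0..1}"
  shows "emeasure square_leb (A \<times> B) = emeasure lborel A * emeasure lborel B"
proof -
  have "A \<times> B \<in> sets (borel \<Otimes>\<^sub>M borel)" using assms by simp
  then have AB: "A \<times> B \<in> sets borel" unfolding borel_prod .
  have "emeasure square_leb (A \<times> B) = emeasure lebesgue (A \<times> B)"
    using assms square_borel by (subst emeasure_restrict_space) auto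
  also have "\<dots> = emeasure (lborel \<Otimes>\<^sub>M lborel) (A \<times> B)"
    using AB by (simp add: lborel_prod)
  also have "\<dots> = emeasure lborel A * emeasure lborel B"
    using assms by (intro lborel.emeasure_pair_measure_Times) auto
  finally show ?thesis .
qed

text \<open>
  The completed measure on the square and the product of two completed measures are different
  measure spaces, but they agree on the smaller sigma-algebra. This lets integrals over the square
  be computed with the product structure, where densities of the two coordinates multiply.
\<close>

lemma distr_square_pair: "distr square_leb (unit_leb \<Otimes>\<^sub>M unit_leb) (\<lambda>z. z) = unit_leb \<Otimes>\<^sub>M unit_leb"
proof (rule pair_measure_eqI[symmetric])
  show "sigma_finite_measure unit_leb" "sigma_finite_measure unit_leb" by unfold_locales
  show "sets (unit_leb \<Otimes>\<^sub>M unit_leb) = sets (distr square_leb (unit_leb \<Otimes>\<^sub>M unit_leb) (\<lambda>z. z))" by simp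
  fix A B :: "real set" assume AB: "A \<in> sets unit_leb" "B \<in> sets unit_leb"
  \<comment> \<open>Replace a Lebesgue set by a Borel set inside the unit interval that differs from it by a null set.\<close>
  have ex: "\<exists>A'. A' \<in> sets borel \<and> A' \<subseteq> {0..1} \<and> (AE x in lborel. x \<in> A \<longleftrightarrow> x \<in> A') \<and> emeasure unit_leb A = emeasure lborel A'"
    if A: "A \<in> sets unit_leb" for A
  proof -
    have A': "A \<in> sets lebesgue" "A \<subseteq> {0..1}"
      using A by (auto simp: sets_restrict_space)
    have ae: "AE x in lborel. x \<in> A \<longleftrightarrow> x \<in> main_part lborel A"
    proof -
      have "AE x in lborel. x \<notin> null_part lborel A"
        using AE_notin_null_part[OF A'(1)] .
      then show ?thesis
        by eventually_elim (use main_part_null_part_Un[OF A'(1)] in auto)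
    qed
    have "main_part lborel A \<subseteq> {0..1}" using main_part_null_part_Un[OF A'(1)] A'(2) by auto
    moreover have "main_part lborel A \<in> sets borel" using main_part_sets[OF A'(1)] by simp
    moreover have "emeasure unit_leb A = emeasure lborel (main_part lborel A)"
      using A' by (subst emeasure_restrict_space) auto
    ultimately show ?thesis using ae by blast
  qed
  obtain A' B' where A': "A' \<in> sets borel" "A' \<subseteq> {0..1}" "AE x in lborel. x \<in> A \<longleftrightarrow> x \<in> A'"
      "emeasure unit_leb A = emeasure lborel A'"
    and B': "B' \<in> sets borel" "B' \<subseteq> {0..1}" "AE x in lborel. x \<in> B \<longleftrightarrow> x \<in> B'"
      "emeasure unit_leb B = emeasure lborel B'"
    using ex[OF AB(1)] ex[OF AB(2)] by blast
  note 1 = measurable_fst_snd_square_borel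
  have ae: "AE z in square_leb. fst z \<in> A \<longleftrightarrow> fst z \<in> A'" "AE z in square_leb. snd z \<in> B \<longleftrightarrow> snd z \<in> B'"
    using nonsingular_AE[OF 1(1) absolutely_continuous_fst_snd(1) A'(3)]
      nonsingular_AE[OF 1(2) absolutely_continuous_fst_snd(2) B'(3)] by auto
  have AB0: "A \<times> B \<in> sets (unit_leb \<Otimes>\<^sub>M unit_leb)" using AB by auto
  have sub: "X \<in> sets square_leb" if X: "X \<in> sets (unit_leb \<Otimes>\<^sub>M unit_leb)" for X
  proof -
    have "X \<subseteq> space square_leb"
      using sets.sets_into_space[OF X] by (simp add: space_pair_measure space_restrict_space)
    then have "(\<lambda>z. z) -` X \<inter> space square_leb = X" by blast
    then show ?thesis using measurable_sets[OF measurable_id_square_pair X] by simp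
  qed
  have m: "A \<times> B \<in> sets square_leb" by (rule sub[OF AB0])
  have "A' \<times> B' \<in> sets (unit_leb \<Otimes>\<^sub>M unit_leb)"
    using A' B' by (intro pair_measureI) (auto simp: sets_restrict_space_iff)
  then have m': "A' \<times> B' \<in> sets square_leb" by (rule sub)
  have "emeasure (distr square_leb (unit_leb \<Otimes>\<^sub>M unit_leb) (\<lambda>z. z)) (A \<times> B) = emeasure square_leb (A \<times> B)"
    using AB0 measurable_id_square_pair sets.sets_into_space[OF m]
    by (simp add: emeasure_distr Int_absorb2)
  also have "\<dots> = emeasure square_leb (A' \<times> B')"
    using ae m m' by (intro emeasure_eq_AE) (auto simp: mem_Times_iff)
  also have "\<dots> = emeasure lborel A' * emeasure lborel B'"
    using A' B' by (intro emeasure_square_borel_Times) auto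
  finally show "emeasure unit_leb A * emeasure unit_leb B =
      emeasure (distr square_leb (unit_leb \<Otimes>\<^sub>M unit_leb) (\<lambda>z. z)) (A \<times> B)"
    using A' B' by simp
qed

lemma measurable_unit_pair_borel:
  "(\<lambda>z. z) \<in> unit_leb \<Otimes>\<^sub>M unit_leb \<rightarrow>\<^sub>M (borel :: (real \<times> real) measure)"
proof -
  have "(\<lambda>x. x) \<in> unit_leb \<rightarrow>\<^sub>M (borel :: real measure)"
    by (intro measurable_restrict_space1 measurable_completion) auto
  note [measurable] = this[THEN measurable_compose[OF measurable_fst]] this[THEN measurable_compose[OF measurable_snd]]
  have "(\<lambda>z. (fst z, snd z)) \<in> unit_leb \<Otimes>\<^sub>M unit_leb \<rightarrow>\<^sub>M (borel \<Otimes>\<^sub>M borel)"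
    by measurable
  then show ?thesis by (simp add: borel_prod)
qed

text \<open>
  The form in which null sets of the plane are transported: a map into the square whose law is the
  product of two uniform laws is nonsingular.
\<close>

lemma absolutely_continuous_pair:
  "absolutely_continuous lborel (distr (unit_leb \<Otimes>\<^sub>M unit_leb) lborel (\<lambda>z. z))"
proof -
  note m = measurable_unit_pair_borel
  have "N \<in> null_sets (distr (unit_leb \<Otimes>\<^sub>M unit_leb) lborel (\<lambda>z. z))" if N: "N \<in> null_sets lborel" for N :: "(real \<times> real) set"
  proof -
    have N': "N \<in> null_sets lebesgue" using N by (rule null_sets_completionI)
    have "emeasure (unit_leb \<Otimes>\<^sub>M unit_leb) (N \<inter> space (unit_leb \<Otimes>\<^sub>M unit_leb)) = emeasure (distr square_leb (unit_leb \<Otimes>\<^sub>M unit_leb) (\<lambda>z. z)) (N \<inter> space (unit_leb \<Otimes>\<^sub>M unit_leb))"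
      by (simp add: distr_square_pair)
    also have "\<dots> = emeasure square_leb (N \<inter> {0..1} \<times> {0..1})"
      using measurable_sets[OF m, of N] N
      by (subst emeasure_distr[OF measurable_id_square_pair]) (auto simp: space_restrict_space space_pair_measure Int_assoc)
    also have "\<dots> = 0"
      using N' square_borel
      by (subst emeasure_restrict_space) (auto intro: emeasure_eq_0[where N=N])
    finally show ?thesis
      using m N by (auto simp: null_sets_def emeasure_distr)
  qed
  then show ?thesis by (auto simp: absolutely_continuous_def)
qed

section \<open>Block graphons and alignment by fractional partitions\<close>

definition level :: "real \<Rightarrow> real \<Rightarrow> (nat \<Rightarrow> nat \<Rightarrow> bool) \<Rightarrow> nat \<Rightarrow> nat \<Rightarrow> real" where
  "level p \<epsilon> s a b = (if s a b then p + \<epsilon> else p - \<epsilon>)"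

text \<open>
  The minimum puts the right end point of the unit interval into the last block.
\<close>

definition block_index :: "nat \<Rightarrow> real \<Rightarrow> nat" where
  "block_index k x = min (k - 1) (nat \<lfloor>real k * x\<rfloor>)"

definition pattern_graphon :: "real \<Rightarrow> real \<Rightarrow> nat \<Rightarrow> (nat \<Rightarrow> nat \<Rightarrow> bool) \<Rightarrow> kernel" where
  "pattern_graphon p \<epsilon> k s = (\<lambda>x y. level p \<epsilon> s (block_index k x) (block_index k y))"

lemma block_index_less: "0 < k \<Longrightarrow> block_index k x < k"
  by (auto simp: block_index_def)

lemma measurable_block_index [measurable]: "block_index k \<in> borel \<rightarrow>\<^sub>M count_space UNIV"
  unfolding block_index_def[abs_def] by measurable

lemma measurable_block_index_unit [measurable]: "block_index k \<in> unit_leb \<rightarrow>\<^sub>M count_space UNIV"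
  using measurable_block_index by (intro measurable_restrict_space1 measurable_completion) simp

lemma measurable_pattern_graphon: "case_prod (pattern_graphon p \<epsilon> k s) \<in> borel_measurable borel"
proof -
  have "case_prod (pattern_graphon p \<epsilon> k s) \<in> borel_measurable (borel \<Otimes>\<^sub>M borel)"
    unfolding pattern_graphon_def level_def split_beta' by measurable
  then show ?thesis by (simp add: borel_prod)
qed

lemma emeasure_block:
  assumes "a < k"
  shows "emeasure unit_leb {x \<in> {0..1}. block_index k x = a} = ennreal (1 / real k)"
proof -
  let ?B = "{x \<in> {0..1}. block_index k x = a}"
  have k: "real k > 0" using assms by simp
  have B: "?B \<in> sets borel" by measurable
  have eq: "emeasure unit_leb ?B = emeasure lborel ?B"
    using B by (subst emeasure_restrict_space) auto
  have len: "ennreal (real (a + 1) / real k - real a / real k) = ennreal (1 / real k)"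
    by (simp add: diff_divide_distrib[symmetric])
  have le: "real a / real k \<le> real (a + 1) / real k" by (intro divide_right_mono) auto
  have "?B \<subseteq> {real a / real k .. real (a + 1) / real k}"
  proof
    fix x assume x: "x \<in> ?B"
    then have x0: "0 \<le> real k * x" "real k * x \<le> real k" using k by (auto simp: mult_left_le)
    have "real a \<le> real k * x \<and> real k * x \<le> real (a + 1)"
    proof (cases "nat \<lfloor>real k * x\<rfloor> \<le> k - 1")
      case True
      then have "nat \<lfloor>real k * x\<rfloor> = a" using x by (auto simp: block_index_def)
      then show ?thesis using x0 by linarith
    next
      case False
      then have "a = k - 1" using x by (auto simp: block_index_def)
      then show ?thesis using x0 False assms by linarith
    qed
    then show "x \<in> {real a / real k .. real (a + 1) / real k}"
      using k by (auto simp: field_simps)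
  qed
  from emeasure_mono[OF this, of lborel] have 1: "emeasure lborel ?B \<le> ennreal (1 / real k)"
    using le len by simp
  have "{real a / real k <..< real (a + 1) / real k} \<subseteq> ?B"
  proof
    fix x assume "x \<in> {real a / real k <..< real (a + 1) / real k}"
    then have x: "real a < real k * x" "real k * x < real (a + 1)" using k by (auto simp: field_simps)
    then have "0 < real k * x" by linarith
    then have "0 \<le> x" using k by (simp add: zero_less_mult_iff)
    moreover have "real k * x \<le> real k * 1" using x assms by linarith
    then have "x \<le> 1" using k by (simp only: mult_le_cancel_left_pos)
    moreover have "nat \<lfloor>real k * x\<rfloor> = a" using x by linarith
    ultimately show "x \<in> ?B" using assms by (auto simp: block_index_def)
  qed
  from emeasure_mono[OF this, of lborel] B have 2: "ennreal (1 / real k) \<le> emeasure lborel ?B"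
    using le len by simp
  show ?thesis using 1 2 eq by (simp add: antisym)
qed

lemma measurable_measure_preserving_pair:
  assumes "\<phi> \<in> measure_preserving_maps"
  shows "(\<lambda>z. (\<phi> (fst z), \<phi> (snd z))) \<in> unit_leb \<Otimes>\<^sub>M unit_leb \<rightarrow>\<^sub>M unit_leb \<Otimes>\<^sub>M unit_leb"
    and "distr (unit_leb \<Otimes>\<^sub>M unit_leb) (unit_leb \<Otimes>\<^sub>M unit_leb) (\<lambda>z. (\<phi> (fst z), \<phi> (snd z)))
           = unit_leb \<Otimes>\<^sub>M unit_leb"
proof -
  have m [measurable]: "\<phi> \<in> unit_leb \<rightarrow>\<^sub>M unit_leb" and d: "distr unit_leb unit_leb \<phi> = unit_leb"
    using assms by (auto simp: measure_preserving_maps_def)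
  show "(\<lambda>z. (\<phi> (fst z), \<phi> (snd z))) \<in> unit_leb \<Otimes>\<^sub>M unit_leb \<rightarrow>\<^sub>M unit_leb \<Otimes>\<^sub>M unit_leb"
    by measurable
  show "distr (unit_leb \<Otimes>\<^sub>M unit_leb) (unit_leb \<Otimes>\<^sub>M unit_leb) (\<lambda>z. (\<phi> (fst z), \<phi> (snd z)))
           = unit_leb \<Otimes>\<^sub>M unit_leb"
    using pair_measure_distr[OF m m] by (simp add: d split_beta' unit_leb.sigma_finite_measure_axioms)
qed

lemma graphon_diff_le_1:
  assumes "graphon V" "graphon W" "x \<in> {0..1}" "y \<in> {0..1}" "x' \<in> {0..1}" "y' \<in> {0..1}"
  shows "\<bar>V x y - W x' y'\<bar> \<le> 1"
proof -
  have "0 \<le> V x y" "V x y \<le> 1" "0 \<le> W x' y'" "W x' y' \<le> 1"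
    using assms by (auto simp: graphon_def)
  then show ?thesis by linarith
qed

lemma prob_space_square_leb: "prob_space square_leb"
  using emeasure_square_borel_Times[of "{0..1}" "{0..1}"]
  by (intro prob_spaceI) (simp add: space_restrict_space)

lemma graphon_compose_nonsingular:
  fixes T :: "'a \<Rightarrow> real \<times> real"
  assumes M: "complete_measure M" and T: "T \<in> M \<rightarrow>\<^sub>M borel" "absolutely_continuous lborel (distr M lborel T)"
    and T01: "\<And>x. x \<in> space M \<Longrightarrow> T x \<in> {0..1} \<times> {0..1}" and W: "graphon W"
  shows "(\<lambda>x. W (fst (T x)) (snd (T x))) \<in> borel_measurable M"
proof -
  have "T \<in> M \<rightarrow>\<^sub>M square_leb"
  proof (rule measurable_restrict_space2)
    show "T \<in> M \<rightarrow>\<^sub>M lebesgue" by (rule nonsingular_measurable_lebesgue[OF M T])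
    show "T \<in> space M \<rightarrow> {0..1} \<times> {0..1}" using T01 by (intro funcsetI)
  qed
  moreover have "case_prod W \<in> borel_measurable square_leb" using W by (simp add: graphon_def)
  ultimately show ?thesis using measurable_compose[of T M square_leb "case_prod W" borel] by (simp add: split_beta)
qed

text \<open>
  An estimator returns an arbitrary Lebesgue measurable graphon. A Borel version of it can be
  composed with a measure preserving map inside the product measure, and changes no integral.
\<close>

lemma graphon_borel_version:
  assumes "graphon V"
  obtains V' :: "real \<times> real \<Rightarrow> real"
  where "V' \<in> borel_measurable borel"
    and "AE z in lborel. z \<in> {0..1} \<times> {0..1} \<longrightarrow> case_prod V z = V' z"
proof -
  have S: "{0..1::real} \<times> {0..1::real} \<in> sets lebesgue" using square_borel by auto
  have "(\<lambda>z. if z \<in> {0..1} \<times> {0..1} then case_prod V z else 0) \<in> borel_measurable lebesgue"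
    using assms S by (subst borel_measurable_if) (auto simp: graphon_def)
  then obtain V' where "V' \<in> borel_measurable lborel"
    "AE z in lborel. (if z \<in> {0..1} \<times> {0..1} then case_prod V z else 0) = V' z"
    using completion_ex_borel_measurable_real by blast
  then show thesis by (intro that[of V']) (auto elim: eventually_mono)
qed

lemma pullback_nonsingular:
  assumes \<phi>: "\<phi> \<in> measure_preserving_maps"
  shows "(\<lambda>z. (\<phi> (fst z), \<phi> (snd z))) \<in> borel_measurable square_leb"
    and "absolutely_continuous lborel (distr square_leb lborel (\<lambda>z. (\<phi> (fst z), \<phi> (snd z))))"
proof -
  let ?P = "unit_leb \<Otimes>\<^sub>M unit_leb" and ?T = "\<lambda>z. (\<phi> (fst z), \<phi> (snd z))"
  note T = measurable_measure_preserving_pair[OF \<phi>]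
  have T': "?T \<in> square_leb \<rightarrow>\<^sub>M ?P"
    using measurable_compose[OF measurable_id_square_pair T(1)] .
  have dT': "distr square_leb ?P ?T = ?P"
    using distr_distr[OF T(1) measurable_id_square_pair] T(2) by (simp add: distr_square_pair comp_def)
  note id = measurable_unit_pair_borel
  show "?T \<in> borel_measurable square_leb"
    using measurable_compose[OF T' id] .
  have "distr square_leb lborel ?T = distr ?P lborel (\<lambda>z. z)"
    using distr_distr[OF _ T', of "\<lambda>z. z" lborel] id dT' by (simp add: comp_def)
  then show "absolutely_continuous lborel (distr square_leb lborel ?T)"
    using absolutely_continuous_pair by simp
qed

lemma l2_norm_pullback_diff:
  assumes V: "graphon V" and V': "V' \<in> borel_measurable borel"
    and VV': "AE z in lborel. z \<in> {0..1} \<times> {0..1} \<longrightarrow> case_prod V z = V' z"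
    and W: "case_prod W \<in> borel_measurable borel" "graphon W"
    and \<phi>: "\<phi> \<in> measure_preserving_maps"
  shows "ennreal ((l2_norm (\<lambda>x y. pullback V \<phi> x y - W x y))\<^sup>2)
       = (\<integral>\<^sup>+z. ennreal ((V' (\<phi> (fst z), \<phi> (snd z)) - W (fst z) (snd z))\<^sup>2) \<partial>(unit_leb \<Otimes>\<^sub>M unit_leb))"
proof -
  let ?P = "unit_leb \<Otimes>\<^sub>M unit_leb" and ?T = "\<lambda>z. (\<phi> (fst z), \<phi> (snd z))"
  let ?D = "\<lambda>z. pullback V \<phi> (fst z) (snd z) - W (fst z) (snd z)"
  note T = pullback_nonsingular[OF \<phi>]
  have \<phi>01: "\<phi> x \<in> {0..1}" if "x \<in> {0..1}" for x
    using \<phi> that measurable_space[of \<phi> unit_leb unit_leb x]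
    by (auto simp: measure_preserving_maps_def space_restrict_space)
  have T01: "?T z \<in> {0..1} \<times> {0..1}" if "z \<in> space square_leb" for z
  proof -
    have "fst z \<in> {0..1}" "snd z \<in> {0..1}" using that by (auto simp: space_restrict_space)
    from \<phi>01[OF this(1)] \<phi>01[OF this(2)] show ?thesis by simp
  qed
  have Wm: "(\<lambda>z. W (fst z) (snd z)) \<in> borel_measurable square_leb"
    using W(1) by (intro measurable_restrict_space1 measurable_completion) (simp add: split_beta')
  have Vm: "(\<lambda>z. pullback V \<phi> (fst z) (snd z)) \<in> borel_measurable square_leb"
    using graphon_compose_nonsingular[OF complete_square_leb T T01 V] by (simp add: pullback_def)
  have Dm: "?D \<in> borel_measurable square_leb"
    using Vm Wm by simp
  have bound: "AE z in square_leb. norm ((?D z)\<^sup>2) \<le> 1"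
  proof (rule AE_I2)
    fix z assume "z \<in> space square_leb"
    then have z: "fst z \<in> {0..1}" "snd z \<in> {0..1}" by (auto simp: space_restrict_space)
    have "\<bar>?D z\<bar> \<le> 1"
      unfolding pullback_def by (rule graphon_diff_le_1[OF V W(2) \<phi>01[OF z(1)] \<phi>01[OF z(2)] z])
    then show "norm ((?D z)\<^sup>2) \<le> 1" by (simp add: abs_square_le_1)
  qed
  interpret sq: prob_space square_leb by (rule prob_space_square_leb)
  have int: "integrable square_leb (\<lambda>z. (?D z)\<^sup>2)"
    using bound Dm by (intro sq.integrable_const_bound) auto
  have "(l2_norm (\<lambda>x y. pullback V \<phi> x y - W x y))\<^sup>2 = (LINT z|square_leb. (?D z)\<^sup>2)"
    by (simp add: l2_norm_def split_beta')
  then have "ennreal ((l2_norm (\<lambda>x y. pullback V \<phi> x y - W x y))\<^sup>2) = (\<integral>\<^sup>+z. ennreal ((?D z)\<^sup>2) \<partial>square_leb)"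
    using nn_integral_eq_integral[OF int] by simp
  also have "\<dots> = (\<integral>\<^sup>+z. ennreal ((V' (?T z) - W (fst z) (snd z))\<^sup>2) \<partial>square_leb)"
  proof (rule nn_integral_cong_AE)
    have "AE z in square_leb. ?T z \<in> {0..1} \<times> {0..1} \<longrightarrow> case_prod V (?T z) = V' (?T z)"
      using nonsingular_AE[OF T VV'] .
    moreover have "AE z in square_leb. z \<in> {0..1} \<times> {0..1}"
      by (rule AE_I2) (auto simp: space_restrict_space)
    ultimately show "AE z in square_leb. ennreal ((?D z)\<^sup>2) = ennreal ((V' (?T z) - W (fst z) (snd z))\<^sup>2)"
    proof eventually_elim
      case (elim z)
      then have "?T z \<in> {0..1} \<times> {0..1}" using \<phi>01 by (metis mem_Sigma_iff mem_Times_iff)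
      with elim have "V' (?T z) = V (\<phi> (fst z)) (\<phi> (snd z))" by simp
      then show ?case by (simp only: pullback_def)
    qed
  qed
  also have "\<dots> = (\<integral>\<^sup>+z. ennreal ((V' (?T z) - W (fst z) (snd z))\<^sup>2) \<partial>(distr square_leb ?P (\<lambda>z. z)))"
  proof -
    have [measurable]: "(\<lambda>z. V' (?T z)) \<in> borel_measurable ?P"
      using measurable_compose[OF measurable_measure_preserving_pair(1)[OF \<phi>]
          measurable_compose[OF measurable_unit_pair_borel V']] .
    have [measurable]: "(\<lambda>z. W (fst z) (snd z)) \<in> borel_measurable ?P"
      using measurable_compose[OF measurable_unit_pair_borel W(1)] by (simp add: split_beta)
    have "(\<lambda>z. ennreal ((V' (?T z) - W (fst z) (snd z))\<^sup>2)) \<in> borel_measurable ?P"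
      by measurable
    then show ?thesis
      by (subst nn_integral_distr[OF measurable_id_square_pair]) simp_all
  qed
  finally show ?thesis by (simp only: distr_square_pair)
qed

text \<open>
  A partition of the unit interval into parts of mass \<open>1 / k\<close> in which a point may be shared between
  parts: \<open>f a x\<close> is the share of \<open>x\<close> that belongs to part \<open>a\<close>.
\<close>

definition fractional_partition :: "nat \<Rightarrow> (nat \<Rightarrow> real \<Rightarrow> ennreal) \<Rightarrow> bool" where
  "fractional_partition k f \<longleftrightarrow>
     (\<forall>a. f a \<in> borel_measurable unit_leb) \<and>
     (\<forall>a<k. (\<integral>\<^sup>+x. f a x \<partial>unit_leb) = ennreal (1 / real k)) \<and>
     (AE x in unit_leb. (\<Sum>a<k. f a x) = 1)"

text \<open>
  Push the \<open>k\<close> blocks forward along \<open>\<phi>\<close>. Each image measure is dominated by Lebesgue measure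
  because \<open>\<phi>\<close> preserves it, and the Radon-Nikodym densities form a fractional partition. The
  alignment of an estimate with a block graphon thereby becomes an object on the domain of the
  estimate alone, and two alignments with different maps become comparable although neither map
  need be invertible.
\<close>

lemma fractional_partition_of_map:
  assumes \<phi>: "\<phi> \<in> measure_preserving_maps" and k: "0 < k"
  obtains f where "fractional_partition k f"
    and "\<And>H. (\<And>a b. H a b \<in> borel_measurable (unit_leb \<Otimes>\<^sub>M unit_leb)) \<Longrightarrow>
      (\<integral>\<^sup>+z. H (block_index k (fst z)) (block_index k (snd z)) (\<phi> (fst z), \<phi> (snd z)) \<partial>(unit_leb \<Otimes>\<^sub>M unit_leb))
      = (\<Sum>a<k. \<Sum>b<k. \<integral>\<^sup>+z. f a (fst z) * f b (snd z) * H a b z \<partial>(unit_leb \<Otimes>\<^sub>M unit_leb))"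
proof -
  have m [measurable]: "\<phi> \<in> unit_leb \<rightarrow>\<^sub>M unit_leb" and d: "distr unit_leb unit_leb \<phi> = unit_leb"
    using \<phi> by (auto simp: measure_preserving_maps_def)
  let ?P = "unit_leb \<Otimes>\<^sub>M unit_leb" and ?T = "\<lambda>z. (\<phi> (fst z), \<phi> (snd z))"
  define I where "I a x = (if block_index k x = a then 1 else 0 :: ennreal)" for a x
  have I [measurable]: "I a \<in> borel_measurable unit_leb" for a
    unfolding I_def[abs_def] by measurable
  \<comment> \<open>The image of the \<open>a\<close>-th block under \<open>\<phi>\<close>, as a measure.\<close>
  define \<mu> where "\<mu> a = distr (density unit_leb (I a)) unit_leb \<phi>" for a
  have m': "\<phi> \<in> density unit_leb (I a) \<rightarrow>\<^sub>M unit_leb" for a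
    using m by (simp add: measurable_density_eq2)
  have emu: "emeasure (\<mu> a) A = (\<integral>\<^sup>+x. I a x * indicator A (\<phi> x) \<partial>unit_leb)" if [measurable]: "A \<in> sets unit_leb" for a A
  proof -
    have "emeasure (\<mu> a) A = (\<integral>\<^sup>+x. indicator A x \<partial>\<mu> a)"
      using that by (simp add: \<mu>_def)
    also have "\<dots> = (\<integral>\<^sup>+x. I a x * indicator A (\<phi> x) \<partial>unit_leb)"
      unfolding \<mu>_def by (subst nn_integral_distr[OF m']) (auto simp: nn_integral_density)
    finally show ?thesis .
  qed
  have "absolutely_continuous unit_leb (\<mu> a)" for a
  proof -
    have "N \<in> null_sets (\<mu> a)" if N: "N \<in> null_sets unit_leb" for N
    proof -
      have N' [measurable]: "N \<in> sets unit_leb" using N by auto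
      have "emeasure (\<mu> a) N \<le> (\<integral>\<^sup>+x. indicator N (\<phi> x) \<partial>unit_leb)"
        unfolding emu[OF N'] by (intro nn_integral_mono) (auto simp: I_def)
      also have "\<dots> = (\<integral>\<^sup>+x. indicator N x \<partial>distr unit_leb unit_leb \<phi>)"
        by (subst nn_integral_distr) auto
      also have "\<dots> = 0" using N unfolding d by (auto simp: null_sets_def)
      finally show ?thesis using N' by (auto simp: null_sets_def \<mu>_def)
    qed
    then show ?thesis by (auto simp: absolutely_continuous_def)
  qed
  then have "\<exists>f. f \<in> borel_measurable unit_leb \<and> density unit_leb f = \<mu> a" for a
    using unit_leb.Radon_Nikodym[of "\<mu> a"] by (auto simp: \<mu>_def)
  then obtain f where f [measurable]: "\<And>a. f a \<in> borel_measurable unit_leb"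
    and fd: "\<And>a. density unit_leb (f a) = \<mu> a" by metis
  have fA: "(\<integral>\<^sup>+x. f a x * indicator A x \<partial>unit_leb) = emeasure (\<mu> a) A" if "A \<in> sets unit_leb" for a A
    using that by (simp add: fd[symmetric] emeasure_density)
  have sumI: "(\<Sum>a<k. I a x) = 1" for x
    using block_index_less[OF k, of x] by (simp add: I_def sum.delta)
  have mass: "(\<integral>\<^sup>+x. f a x \<partial>unit_leb) = ennreal (1 / real k)" if "a < k" for a
  proof -
    have "(\<integral>\<^sup>+x. f a x \<partial>unit_leb) = (\<integral>\<^sup>+x. f a x * indicator (space unit_leb) x \<partial>unit_leb)"
      by (intro nn_integral_cong) auto
    also have "\<dots> = (\<integral>\<^sup>+x. I a x * indicator (space unit_leb) (\<phi> x) \<partial>unit_leb)"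
      using fA[of "space unit_leb" a] emu[of "space unit_leb" a] by simp
    also have "\<dots> = (\<integral>\<^sup>+x. indicator {x \<in> {0..1}. block_index k x = a} x \<partial>unit_leb)"
      using measurable_space[OF m]
      by (intro nn_integral_cong) (auto simp: I_def space_restrict_space split: split_indicator)
    also have "\<dots> = emeasure unit_leb {x \<in> {0..1}. block_index k x = a}"
    proof (rule nn_integral_indicator)
      have "{x \<in> space unit_leb. block_index k x = a} \<in> sets unit_leb" by measurable
      then show "{x \<in> {0..1}. block_index k x = a} \<in> sets unit_leb" by (simp add: space_restrict_space)
    qed
    also have "\<dots> = ennreal (1 / real k)" by (rule emeasure_block[OF that])
    finally show ?thesis .
  qed
  have "density unit_leb (\<lambda>x. \<Sum>a<k. f a x) = density unit_leb (\<lambda>_. 1)"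
  proof (rule measure_eqI)
    fix A assume "A \<in> sets (density unit_leb (\<lambda>x. \<Sum>a<k. f a x))"
    then have A [measurable]: "A \<in> sets unit_leb" by simp
    have "emeasure (density unit_leb (\<lambda>x. \<Sum>a<k. f a x)) A = (\<Sum>a<k. \<integral>\<^sup>+x. f a x * indicator A x \<partial>unit_leb)"
      by (subst nn_integral_sum[symmetric]) (auto simp: emeasure_density sum_distrib_right)
    also have "\<dots> = (\<Sum>a<k. \<integral>\<^sup>+x. I a x * indicator A (\<phi> x) \<partial>unit_leb)"
      by (simp add: fA emu)
    also have "\<dots> = (\<integral>\<^sup>+x. (\<Sum>a<k. I a x) * indicator A (\<phi> x) \<partial>unit_leb)"
      by (subst nn_integral_sum[symmetric]) (auto simp: sum_distrib_right)
    also have "\<dots> = (\<integral>\<^sup>+x. indicator A x \<partial>distr unit_leb unit_leb \<phi>)"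
      unfolding sumI by (subst nn_integral_distr) auto
    also have "\<dots> = emeasure (density unit_leb (\<lambda>_. 1)) A"
      unfolding d by (simp add: emeasure_density)
    finally show "emeasure (density unit_leb (\<lambda>x. \<Sum>a<k. f a x)) A = emeasure (density unit_leb (\<lambda>_. 1)) A" .
  qed simp
  then have "AE x in unit_leb. (\<Sum>a<k. f a x) = 1"
    by (subst (asm) unit_leb.density_unique_iff) auto
  with mass have fp: "fractional_partition k f" by (simp add: fractional_partition_def)
  have pairs: "(\<integral>\<^sup>+z. I a (fst z) * I b (snd z) * h (?T z) \<partial>?P) = (\<integral>\<^sup>+z. f a (fst z) * f b (snd z) * h z \<partial>?P)"
    if ab: "a < k" "b < k" and h [measurable]: "h \<in> borel_measurable ?P" for a b h
  proof -
    have fin: "finite_measure (\<mu> a)" if "a < k" for a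
    proof (rule finite_measureI)
      have "emeasure (\<mu> a) (space (\<mu> a)) = emeasure (\<mu> a) (space unit_leb)"
        by (simp add: \<mu>_def)
      also have "\<dots> = (\<integral>\<^sup>+x. f a x * indicator (space unit_leb) x \<partial>unit_leb)"
        by (rule fA[symmetric]) simp
      also have "\<dots> = (\<integral>\<^sup>+x. f a x \<partial>unit_leb)" by (intro nn_integral_cong) auto
      finally show "emeasure (\<mu> a) (space (\<mu> a)) \<noteq> \<infinity>" using mass[OF that] by simp
    qed
    have sf: "sigma_finite_measure (\<mu> a)" "sigma_finite_measure (\<mu> b)"
      using fin ab by (auto simp: finite_measure_def)
    have sfI: "sigma_finite_measure (density unit_leb (I c))" for c
    proof -
      have "finite_measure (density unit_leb (I c))"
      proof (rule finite_measureI)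
        have "emeasure (density unit_leb (I c)) (space (density unit_leb (I c)))
            = (\<integral>\<^sup>+x. I c x * indicator (space unit_leb) x \<partial>unit_leb)"
          by (simp only: space_density) (rule emeasure_density, simp_all only: I sets.top)
        also have "\<dots> \<le> (\<integral>\<^sup>+x. 1 \<partial>unit_leb)"
          by (intro nn_integral_mono) (auto simp: I_def split: split_indicator)
        also have "(\<integral>\<^sup>+x. 1 \<partial>unit_leb) = 1"
          by (simp only: nn_integral_const unit_leb.emeasure_space_1 mult_1)
        finally show "emeasure (density unit_leb (I c)) (space (density unit_leb (I c))) \<noteq> \<infinity>"
          using ennreal_one_less_top by (metis infinity_ennreal_def leD)
      qed
      then show ?thesis by (simp add: finite_measure_def)
    qed
    have T: "?T \<in> ?P \<rightarrow>\<^sub>M ?P" by measurable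
    have T': "?T \<in> density ?P (\<lambda>(x, y). I a x * I b y) \<rightarrow>\<^sub>M ?P" using T by (simp add: measurable_density_eq2)
    have "(\<integral>\<^sup>+z. I a (fst z) * I b (snd z) * h (?T z) \<partial>?P) = (\<integral>\<^sup>+z. h (?T z) \<partial>density ?P (\<lambda>(x, y). I a x * I b y))"
      by (subst nn_integral_density) (auto simp: split_beta')
    also have "\<dots> = (\<integral>\<^sup>+z. h z \<partial>distr (density ?P (\<lambda>(x, y). I a x * I b y)) ?P ?T)"
      by (rule nn_integral_distr[symmetric, OF T']) simp
    also have "density ?P (\<lambda>(x, y). I a x * I b y) = density unit_leb (I a) \<Otimes>\<^sub>M density unit_leb (I b)"
      by (rule pair_measure_density[symmetric]) (use sfI unit_leb.sigma_finite_measure_axioms in auto)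
    also have "distr (density unit_leb (I a) \<Otimes>\<^sub>M density unit_leb (I b)) ?P ?T = \<mu> a \<Otimes>\<^sub>M \<mu> b"
      using pair_measure_distr[OF m' m', of b a] sf(2) unfolding \<mu>_def by (simp add: split_beta')
    also have "\<mu> a \<Otimes>\<^sub>M \<mu> b = density unit_leb (f a) \<Otimes>\<^sub>M density unit_leb (f b)"
      by (simp only: fd)
    also have "\<dots> = density ?P (\<lambda>(x, y). f a x * f b y)"
      by (rule pair_measure_density) (use sf unit_leb.sigma_finite_measure_axioms in \<open>auto simp: fd\<close>)
    also have "(\<integral>\<^sup>+z. h z \<partial>\<dots>) = (\<integral>\<^sup>+z. f a (fst z) * f b (snd z) * h z \<partial>?P)"
      by (subst nn_integral_density) (auto simp: split_beta')
    finally show ?thesis .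
  qed
  show thesis
  proof (rule that[OF fp])
    fix H :: "nat \<Rightarrow> nat \<Rightarrow> real \<times> real \<Rightarrow> ennreal"
    assume H [measurable]: "\<And>a b. H a b \<in> borel_measurable ?P"
    have pick: "(\<Sum>b<k. I b y * G b) = G (block_index k y)" for y G
    proof -
      have "(\<Sum>b<k. I b y * G b) = (\<Sum>b<k. if block_index k y = b then G b else 0)"
        by (intro sum.cong) (auto simp: I_def)
      then show ?thesis using block_index_less[OF k, of y] by simp
    qed
    have split: "H (block_index k x) (block_index k y) w = (\<Sum>a<k. \<Sum>b<k. I a x * I b y * H a b w)" for x y w
      unfolding mult.assoc sum_distrib_left[symmetric] pick ..
    have T [measurable]: "?T \<in> ?P \<rightarrow>\<^sub>M ?P" by measurable
    have [measurable]: "(\<lambda>z. H a b (?T z)) \<in> borel_measurable ?P" for a b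
      using measurable_compose[OF T H] .
    have "(\<integral>\<^sup>+z. H (block_index k (fst z)) (block_index k (snd z)) (?T z) \<partial>?P)
      = (\<Sum>a<k. \<Sum>b<k. \<integral>\<^sup>+z. I a (fst z) * I b (snd z) * H a b (?T z) \<partial>?P)"
      unfolding split by (simp add: nn_integral_sum)
    also have "\<dots> = (\<Sum>a<k. \<Sum>b<k. \<integral>\<^sup>+z. f a (fst z) * f b (snd z) * H a b z \<partial>?P)"
      by (intro sum.cong pairs) auto
    finally show "(\<integral>\<^sup>+z. H (block_index k (fst z)) (block_index k (snd z)) (?T z) \<partial>?P) = \<dots>" .
  qed
qed

lemma average_ge_minimum_ennreal:
  fixes w C :: "nat \<Rightarrow> ennreal"
  assumes "0 < k" "(\<Sum>i<k. w i) = K"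
  shows "\<exists>i<k. K * C i \<le> (\<Sum>i<k. w i * C i)"
proof -
  have "\<exists>i\<in>{..<k}. \<forall>j\<in>{..<k}. C i \<le> C j"
    using assms(1) by (metis arg_min_if_finite(1) arg_min_least empty_iff finite_lessThan lessThan_iff)
  then obtain i where i: "i < k" "\<And>j. j < k \<Longrightarrow> C i \<le> C j" by auto
  have "K * C i = (\<Sum>j<k. w j * C i)" by (simp add: assms(2)[symmetric] sum_distrib_right)
  also have "\<dots> \<le> (\<Sum>j<k. w j * C j)" using i(2) by (intro sum_mono mult_left_mono) auto
  finally show ?thesis using i(1) by blast
qed

text \<open>
  The cost is quadratic in the coupling, but bilinear once the two occurrences of \<open>\<pi>\<close> are treated as
  independent variables. A linear function of a matrix with prescribed row sums is minimised by
  putting the mass of each row on one entry, so the first and then the second occurrence can be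
  replaced by a map without increasing the cost. Only the row sums are kept, hence the maps need
  not be permutations; for the counting argument it suffices that there are at most \<open>k ^ k\<close> of them.
\<close>

lemma round_coupling:
  fixes \<pi> :: "nat \<Rightarrow> nat \<Rightarrow> ennreal" and c :: "nat \<Rightarrow> nat \<Rightarrow> nat \<Rightarrow> nat \<Rightarrow> ennreal"
  assumes k: "0 < k" and \<pi>: "\<And>a. a < k \<Longrightarrow> (\<Sum>a'<k. \<pi> a a') = K"
  shows "\<exists>\<sigma>\<in>{..<k} \<rightarrow> {..<k}. \<exists>\<tau>\<in>{..<k} \<rightarrow> {..<k}.
    (\<Sum>a<k. \<Sum>b<k. K * K * c a b (\<sigma> a) (\<tau> b))
       \<le> (\<Sum>a<k. \<Sum>a'<k. \<Sum>b<k. \<Sum>b'<k. \<pi> a a' * \<pi> b b' * c a b a' b')"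
proof -
  define C where "C a a' = (\<Sum>b<k. \<Sum>b'<k. \<pi> b b' * c a b a' b')" for a a'
  have "\<exists>a'<k. K * C a a' \<le> (\<Sum>a'<k. \<pi> a a' * C a a')" if "a < k" for a
    using average_ge_minimum_ennreal[OF k \<pi>[OF that]] .
  then obtain \<sigma> where \<sigma>: "\<And>a. a < k \<Longrightarrow> \<sigma> a < k"
    "\<And>a. a < k \<Longrightarrow> K * C a (\<sigma> a) \<le> (\<Sum>a'<k. \<pi> a a' * C a a')" by metis
  define D where "D b b' = (\<Sum>a<k. K * c a b (\<sigma> a) b')" for b b'
  have "\<exists>b'<k. K * D b b' \<le> (\<Sum>b'<k. \<pi> b b' * D b b')" if "b < k" for b
    using average_ge_minimum_ennreal[OF k \<pi>[OF that]] .
  then obtain \<tau> where \<tau>: "\<And>a. a < k \<Longrightarrow> \<tau> a < k"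
    "\<And>a. a < k \<Longrightarrow> K * D a (\<tau> a) \<le> (\<Sum>a'<k. \<pi> a a' * D a a')" by metis
  have "(\<Sum>a<k. \<Sum>b<k. K * K * c a b (\<sigma> a) (\<tau> b)) = (\<Sum>b<k. K * D b (\<tau> b))"
    unfolding D_def sum_distrib_left by (subst sum.swap) (simp add: mult_ac)
  also have "\<dots> \<le> (\<Sum>b<k. \<Sum>b'<k. \<pi> b b' * D b b')" by (intro sum_mono \<tau>(2)) auto
  also have "\<dots> = (\<Sum>b<k. \<Sum>b'<k. \<Sum>a<k. K * (\<pi> b b' * c a b (\<sigma> a) b'))"
    unfolding D_def sum_distrib_left by (simp add: mult_ac)
  also have "\<dots> = (\<Sum>b<k. \<Sum>a<k. \<Sum>b'<k. K * (\<pi> b b' * c a b (\<sigma> a) b'))"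
    by (intro sum.cong refl sum.swap)
  also have "\<dots> = (\<Sum>a<k. \<Sum>b<k. \<Sum>b'<k. K * (\<pi> b b' * c a b (\<sigma> a) b'))"
    by (rule sum.swap)
  also have "\<dots> = (\<Sum>a<k. K * C a (\<sigma> a))"
    unfolding C_def by (simp add: sum_distrib_left)
  also have "\<dots> \<le> (\<Sum>a<k. \<Sum>a'<k. \<pi> a a' * C a a')" by (intro sum_mono \<sigma>(2)) auto
  also have "\<dots> = (\<Sum>a<k. \<Sum>a'<k. \<Sum>b<k. \<Sum>b'<k. \<pi> a a' * \<pi> b b' * c a b a' b')"
    unfolding C_def by (simp add: sum_distrib_left mult.assoc)
  finally have le: "(\<Sum>a<k. \<Sum>b<k. K * K * c a b (\<sigma> a) (\<tau> b))
      \<le> (\<Sum>a<k. \<Sum>a'<k. \<Sum>b<k. \<Sum>b'<k. \<pi> a a' * \<pi> b b' * c a b a' b')" .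
  have "\<sigma> \<in> {..<k} \<rightarrow> {..<k}" "\<tau> \<in> {..<k} \<rightarrow> {..<k}" using \<sigma>(1) \<tau>(1) by auto
  with le show ?thesis by blast
qed

section \<open>Families of sign patterns that resist relabelling\<close>

text \<open>
  The relation forced on two patterns whose block graphons are both close to one estimate. The rows
  and the columns are relabelled by unrelated maps, not by one permutation, because this is what the
  rounding of a coupling produces.
\<close>

definition nearly_matches :: "nat \<Rightarrow> (nat \<Rightarrow> nat \<Rightarrow> bool) \<Rightarrow> (nat \<Rightarrow> nat \<Rightarrow> bool) \<Rightarrow> bool" where
  "nearly_matches k s s' \<longleftrightarrow>
     (\<exists>\<sigma>\<in>{..<k} \<rightarrow>\<^sub>E {..<k}. \<exists>\<tau>\<in>{..<k} \<rightarrow>\<^sub>E {..<k}.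
        16 * card {(a, b). a < k \<and> b < k \<and> s a b \<noteq> s' (\<sigma> a) (\<tau> b)} < k\<^sup>2)"

text \<open>
  If the truth is uniformly distributed on such a family, it nearly matches a fixed member \<open>s'\<close> with
  probability at most \<open>\<beta>\<close>; this is the success probability of guessing without data.
\<close>

definition separated_family :: "nat \<Rightarrow> real \<Rightarrow> (nat \<Rightarrow> nat \<Rightarrow> bool) set \<Rightarrow> bool" where
  "separated_family k \<beta> S \<longleftrightarrow> finite S \<and> S \<noteq> {} \<and> (\<forall>s\<in>S. \<forall>a b. s a b = s b a) \<and>
    (\<forall>s'\<in>S. real (card {s\<in>S. nearly_matches k s s'}) \<le> \<beta> * real (card S))"

text \<open>
  The generating function \<open>\<Sum>A. x ^ card A\<close> over the subsets of \<open>T\<close> equals \<open>(1 + x) ^ card T\<close>, and at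
  \<open>x = 1/3\<close> each set of a ball around the empty set has weight at least \<open>3 powr (- card T / 8)\<close>. This bounds the size
  of the ball by \<open>(4/3 * 3 powr (1/8)) ^ card T\<close>, where \<open>4/3 * 3 powr (1/8) < 8/5\<close>.
\<close>

lemma hamming_ball_bound:
  assumes T: "finite T" and M: "M \<subseteq> T"
  shows "real (card {A \<in> Pow T. 8 * card (sym_diff A M) \<le> card T}) \<le> 2 ^ card T * (4/5) ^ card T"
proof -
  let ?N = "card T" and ?B = "{A \<in> Pow T. 8 * card (sym_diff A M) \<le> card T}"
  define r :: real where "r = 3 powr (1/8)"
  have r: "r > 0" "r \<le> 23/20"
  proof -
    show "r > 0" by (simp add: r_def)
    have "r ^ 8 = 3" by (simp add: r_def powr_power)
    also have "\<dots> \<le> (23/20) ^ 8" by (simp add: field_simps)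
    finally show "r \<le> 23/20" by (rule power_le_imp_le_base[of _ 7, simplified]) simp
  qed
  have r8: "r ^ 8 = 3" by (simp add: r_def powr_power)
  \<comment> \<open>Translation by \<open>M\<close> moves the centre of the ball to the empty set.\<close>
  have bij: "bij_betw (\<lambda>A. sym_diff A M) (Pow T) (Pow T)"
    by (rule bij_betw_byWitness[where f'="\<lambda>A. sym_diff A M"]) (use M in auto)
  have "real (card ?B) * (1 / r) ^ ?N \<le> (\<Sum>A\<in>?B. (1/3) ^ card (sym_diff A M))"
  proof -
    have "(1 / r) ^ ?N \<le> (1/3) ^ card (sym_diff A M)" if "A \<in> ?B" for A
    proof -
      have "1 \<le> r" unfolding r_def by (simp add: ge_one_powr_ge_zero)
      then have "(1 / r) ^ ?N \<le> (1 / r) ^ (8 * card (sym_diff A M))"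
        using that r by (intro power_decreasing) auto
      also have "\<dots> = (1/3) ^ card (sym_diff A M)"
        by (simp only: power_mult power_divide r8 power_one)
      finally show ?thesis .
    qed
    then have "(\<Sum>A\<in>?B. (1 / r) ^ ?N) \<le> (\<Sum>A\<in>?B. (1/3) ^ card (sym_diff A M))" by (intro sum_mono)
    then show ?thesis by simp
  qed
  also have "\<dots> \<le> (\<Sum>A\<in>Pow T. (1/3) ^ card (sym_diff A M))"
    using T by (intro sum_mono2) auto
  also have "\<dots> = (\<Sum>A\<in>Pow T. (1/3) ^ card A)"
    by (rule sum.reindex_bij_betw[OF bij])
  also have "\<dots> = (\<Sum>A\<in>Pow T. (\<Prod>a\<in>A. 1/3) * (\<Prod>a\<in>T - A. 1))" by simp
  also have "\<dots> = (\<Prod>a\<in>T. 1/3 + 1)"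
    by (rule prod_add[OF T, symmetric])
  also have "\<dots> = (4/3) ^ ?N" by simp
  finally have "real (card ?B) * (1 / r) ^ ?N \<le> (4/3) ^ ?N" .
  then have "real (card ?B) \<le> (4/3) ^ ?N * r ^ ?N"
    using r by (simp add: power_one_over field_simps)
  also have "\<dots> = (4/3 * r) ^ ?N" by (rule power_mult_distrib[symmetric])
  also have "\<dots> \<le> (2 * (4/5)) ^ ?N" using r by (intro power_mono) auto
  finally show ?thesis by (simp only: power_mult_distrib)
qed

text \<open>
  All symmetric patterns. For fixed relabellings the patterns that nearly match \<open>s'\<close> lie in a Hamming
  ball, which is exponentially small in \<open>k\<^sup>2\<close>, while the number of pairs of relabellings is only
  \<open>k ^ (2 * k)\<close>.
\<close>

lemma separated_patterns_large:
  assumes k: "1 \<le> k"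
  shows "\<exists>S. separated_family k (((real k)\<^sup>2 * (9/10) ^ k) ^ k) S"
proof -
  define T where "T = {(a, b). a \<le> b \<and> b < k}"
  define pat where "pat A = (\<lambda>a b. (min a b, max a b) \<in> A)" for A :: "(nat \<times> nat) set"
  have Tsub: "T \<subseteq> {..<k} \<times> {..<k}" by (auto simp: T_def)
  then have finT: "finite T" by (rule finite_subset) auto
  have cardT: "2 * card T \<ge> k\<^sup>2"
  proof -
    have "{..<k} \<times> {..<k} \<subseteq> T \<union> prod.swap ` T"
    proof
      fix z assume "z \<in> {..<k} \<times> {..<k}"
      then show "z \<in> T \<union> prod.swap ` T"
        by (cases z; cases "fst z \<le> snd z") (auto simp: T_def image_iff)
    qed
    then have "card ({..<k} \<times> {..<k}) \<le> card (T \<union> prod.swap ` T)"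
      using finT by (intro card_mono) auto
    also have "\<dots> \<le> card T + card (prod.swap ` T)" by (rule card_Un_le)
    also have "\<dots> \<le> card T + card T" using card_image_le[OF finT] by simp
    finally show ?thesis by (simp add: power2_eq_square)
  qed
  have inj: "inj_on pat (Pow T)"
  proof (rule inj_onI)
    fix A B assume AB: "A \<in> Pow T" "B \<in> Pow T" "pat A = pat B"
    have "z \<in> A \<longleftrightarrow> z \<in> B" for z
    proof (cases "z \<in> T")
      case True
      then have "z = (min (fst z) (snd z), max (fst z) (snd z))" by (auto simp: T_def)
      then show ?thesis using AB(3) unfolding pat_def by (metis (mono_tags))
    qed (use AB in auto)
    then show "A = B" by auto
  qed
  define S where "S = pat ` Pow T"
  have cardS: "card S = 2 ^ card T" unfolding S_def by (simp add: card_image[OF inj] card_Pow finT)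
  have near: "real (card {s\<in>S. nearly_matches k s s'}) \<le> ((real k)\<^sup>2 * (9/10) ^ k) ^ k * real (card S)" for s'
  proof -
    define F where "F = {..<k} \<rightarrow>\<^sub>E {..<k}"
    define M where "M \<sigma> \<tau> = {(a, b) \<in> T. s' (\<sigma> a) (\<tau> b)}" for \<sigma> \<tau> :: "nat \<Rightarrow> nat"
    define B where "B \<sigma> \<tau> = {A \<in> Pow T. 8 * card (sym_diff A (M \<sigma> \<tau>)) \<le> card T}" for \<sigma> \<tau>
    have finF: "finite F" unfolding F_def by (intro finite_PiE) auto
    have cardF: "card F = k ^ k" unfolding F_def by (simp add: card_PiE)
    have "{s\<in>S. nearly_matches k s s'} \<subseteq> pat ` (\<Union>(\<sigma>, \<tau>)\<in>F \<times> F. B \<sigma> \<tau>)"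
    proof
      fix s assume "s \<in> {s\<in>S. nearly_matches k s s'}"
      then obtain A \<sigma> \<tau> where A: "A \<subseteq> T" "s = pat A" and \<sigma>: "\<sigma> \<in> F" "\<tau> \<in> F"
        and c: "16 * card {(a, b). a < k \<and> b < k \<and> s a b \<noteq> s' (\<sigma> a) (\<tau> b)} < k\<^sup>2"
        by (auto simp: S_def nearly_matches_def F_def)
      have "sym_diff A (M \<sigma> \<tau>) \<subseteq> {(a, b). a < k \<and> b < k \<and> s a b \<noteq> s' (\<sigma> a) (\<tau> b)}"
      proof
        fix z assume z: "z \<in> sym_diff A (M \<sigma> \<tau>)"
        then have "z \<in> T" using A by (auto simp: M_def)
        then obtain a b where ab: "z = (a, b)" "a \<le> b" "b < k" by (auto simp: T_def)
        then have "s a b \<longleftrightarrow> z \<in> A" by (simp add: A pat_def)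
        with z \<open>z \<in> T\<close> ab show "z \<in> {(a, b). a < k \<and> b < k \<and> s a b \<noteq> s' (\<sigma> a) (\<tau> b)}"
          by (auto simp: M_def)
      qed
      moreover have "finite {(a, b). a < k \<and> b < k \<and> s a b \<noteq> s' (\<sigma> a) (\<tau> b)}"
        by (rule finite_subset[of _ "{..<k} \<times> {..<k}"]) auto
      ultimately have "card (sym_diff A (M \<sigma> \<tau>)) \<le> card {(a, b). a < k \<and> b < k \<and> s a b \<noteq> s' (\<sigma> a) (\<tau> b)}"
        by (intro card_mono)
      then have "A \<in> B \<sigma> \<tau>" using c cardT A by (auto simp: B_def)
      then show "s \<in> pat ` (\<Union>(\<sigma>, \<tau>)\<in>F \<times> F. B \<sigma> \<tau>)" using A \<sigma> by auto
    qed
    moreover have finB: "finite (\<Union>(\<sigma>, \<tau>)\<in>F \<times> F. B \<sigma> \<tau>)"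
      using finT finF by (auto simp: B_def)
    ultimately have "card {s\<in>S. nearly_matches k s s'} \<le> card (\<Union>(\<sigma>, \<tau>)\<in>F \<times> F. B \<sigma> \<tau>)"
      by (meson card_image_le card_mono finite_imageI le_trans)
    also have "\<dots> \<le> (\<Sum>x\<in>F \<times> F. card (case x of (\<sigma>, \<tau>) \<Rightarrow> B \<sigma> \<tau>))"
      using finF by (intro card_UN_le) auto
    finally have "real (card {s\<in>S. nearly_matches k s s'}) \<le> real (\<Sum>x\<in>F \<times> F. card (case x of (\<sigma>, \<tau>) \<Rightarrow> B \<sigma> \<tau>))"
      by (rule of_nat_mono)
    also have "\<dots> = (\<Sum>x\<in>F \<times> F. real (card (case x of (\<sigma>, \<tau>) \<Rightarrow> B \<sigma> \<tau>)))"
      by (rule of_nat_sum)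
    also have "\<dots> \<le> (\<Sum>x\<in>F \<times> F. 2 ^ card T * (4/5) ^ card T)"
    proof (intro sum_mono)
      fix x
      have "M (fst x) (snd x) \<subseteq> T" by (auto simp: M_def)
      from hamming_ball_bound[OF finT this]
      show "real (card (case x of (\<sigma>, \<tau>) \<Rightarrow> B \<sigma> \<tau>)) \<le> 2 ^ card T * (4/5) ^ card T"
        by (simp only: B_def split_beta)
    qed
    also have "\<dots> = (real k ^ k)\<^sup>2 * (4/5) ^ card T * 2 ^ card T"
      by (simp add: cardF card_cartesian_product power2_eq_square)
    also have "\<dots> \<le> (real k ^ k)\<^sup>2 * (9/10) ^ (k\<^sup>2) * 2 ^ card T"
    proof -
      \<comment> \<open>\<open>4/5 \<le> (9/10)\<^sup>2\<close>, and \<open>T\<close> contains at least half of all \<open>k\<^sup>2\<close> entries.\<close>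
      have "(4/5 :: real) ^ card T \<le> ((9/10)\<^sup>2) ^ card T" by (intro power_mono) (auto simp: power2_eq_square)
      also have "\<dots> = (9/10 :: real) ^ (2 * card T)" by (rule power_mult[symmetric])
      also have "\<dots> \<le> (9/10) ^ (k\<^sup>2)" using cardT by (intro power_decreasing) auto
      finally show ?thesis by (intro mult_right_mono mult_left_mono) auto
    qed
    also have "\<dots> = ((real k)\<^sup>2 * (9/10) ^ k) ^ k * real (card S)"
      by (simp add: cardS power_mult_distrib power_mult[symmetric] power2_eq_square mult.commute)
    finally show ?thesis .
  qed
  have sym: "\<forall>s\<in>S. \<forall>a b. s a b = s b a"
    by (auto simp: S_def pat_def min.commute max.commute)
  have "finite S" "S \<noteq> {}" using finT by (auto simp: S_def)
  with near sym have "separated_family k (((real k)\<^sup>2 * (9/10) ^ k) ^ k) S"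
    by (auto simp: separated_family_def)
  then show ?thesis ..
qed

text \<open>
  For few blocks the union bound over the relabellings is useless, but two constant patterns remain
  distinguishable under every relabelling.
\<close>

lemma separated_patterns_constant:
  assumes k: "1 \<le> k"
  shows "\<exists>S. separated_family k (1/2) S"
proof (intro exI, unfold separated_family_def, intro conjI ballI allI)
  let ?S = "{\<lambda>_ _. True, \<lambda>_ _. False} :: (nat \<Rightarrow> nat \<Rightarrow> bool) set"
  show "finite ?S" "?S \<noteq> {}" by auto
  show "s a b = s b a" if "s \<in> ?S" for s a b using that by auto
  fix s' assume s': "s' \<in> ?S"
  have "{(a, b). a < k \<and> b < k} = {..<k} \<times> {..<k}" by auto
  then have full: "card {(a, b). a < k \<and> b < k} = k\<^sup>2" by (simp add: power2_eq_square)
  have "s = s'" if s: "s \<in> ?S" "nearly_matches k s s'" for s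
  proof (rule ccontr)
    assume "s \<noteq> s'"
    then have "s a b \<noteq> s' c d" for a b c d using s(1) s' by blast
    then have "{(a, b). a < k \<and> b < k \<and> s a b \<noteq> s' (\<sigma> a) (\<tau> b)} = {(a, b). a < k \<and> b < k}" for \<sigma> \<tau>
      by blast
    then have "16 * k\<^sup>2 < k\<^sup>2" using s(2) full by (simp only: nearly_matches_def) blast
    then show False by simp
  qed
  then have "{s\<in>?S. nearly_matches k s s'} \<subseteq> {s'}" by blast
  then have "card {s\<in>?S. nearly_matches k s s'} \<le> 1"
    using card_mono[of "{s'}"] by fastforce
  moreover have "card ?S = 2" by (auto simp: fun_eq_iff card_insert_if)
  ultimately show "real (card {s\<in>?S. nearly_matches k s s'}) \<le> 1/2 * real (card ?S)" by simp
qed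

lemma separated_family_mono: "separated_family k \<beta> S \<Longrightarrow> \<beta> \<le> \<beta>' \<Longrightarrow> separated_family k \<beta>' S"
  unfolding separated_family_def by (meson mult_right_mono of_nat_0_le_iff order_trans)

text \<open>
  All symmetric patterns serve for large \<open>k\<close> and two constant patterns for the finitely many small
  \<open>k\<close>; for these \<open>\<kappa>\<close> only has to be small enough.
\<close>

lemma separated_patterns:
  "\<exists>\<kappa>>0. \<forall>k\<ge>1. \<exists>S. separated_family k (2/3 * exp (- \<kappa> * (real k)\<^sup>2)) S"
proof -
  have "((\<lambda>k::nat. (real k)\<^sup>2 * (19/20) ^ k) \<longlongrightarrow> 0) at_top" by real_asymp
  then have "eventually (\<lambda>k. (real k)\<^sup>2 * (19/20) ^ k < 2/3) at_top"
    by (rule order_tendstoD) simp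
  then obtain k0 where k0: "\<And>k. k \<ge> k0 \<Longrightarrow> (real k)\<^sup>2 * (19/20) ^ k < 2/3"
    by (auto simp: eventually_at_top_linorder)
  \<comment> \<open>The factor \<open>exp \<kappa> \<le> 19/18\<close> turns \<open>9/10\<close> into \<open>19/20\<close>, which is still below one; for
    \<open>k \<le> k0\<close> the exponential stays above \<open>3/4\<close>.\<close>
  define \<kappa> where "\<kappa> = min (ln (19/18)) (ln (4/3) / (real k0 + 1)\<^sup>2)"
  have \<kappa>: "\<kappa> > 0" "\<kappa> \<le> ln (19/18)" "\<kappa> \<le> ln (4/3) / (real k0 + 1)\<^sup>2" by (auto simp: \<kappa>_def)
  have "\<exists>S. separated_family k (2/3 * exp (- \<kappa> * (real k)\<^sup>2)) S" if k: "k \<ge> 1" for k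
  proof (cases "k \<ge> k0")
    case True
    have "- ln (19/18) * (real k)\<^sup>2 \<le> - \<kappa> * (real k)\<^sup>2"
      using \<kappa>(2) by (intro mult_right_mono) auto
    moreover have "exp (- ln (19/18) * (real k)\<^sup>2) = ((18/19) ^ k) ^ k"
    proof -
      have "exp (- ln (19/18)) = (18/19 :: real)" by (simp add: exp_minus)
      moreover have "exp (- ln (19/18) * (real k)\<^sup>2) = exp (- ln (19/18)) ^ (k * k)"
        by (simp only: exp_of_nat_mult[symmetric] of_nat_mult power2_eq_square mult_ac)
      ultimately show ?thesis by (simp only: power_mult)
    qed
    ultimately have e: "((18/19) ^ k) ^ k \<le> exp (- \<kappa> * (real k)\<^sup>2)"
      by (metis exp_le_cancel_iff)
    have "((real k)\<^sup>2 * (9/10) ^ k) ^ k = ((real k)\<^sup>2 * (19/20 * (18/19)) ^ k) ^ k" by simp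
    also have "\<dots> = ((real k)\<^sup>2 * (19/20) ^ k) ^ k * ((18/19) ^ k) ^ k"
      by (simp only: power_mult_distrib mult_ac)
    also have "\<dots> \<le> (2/3) ^ k * exp (- \<kappa> * (real k)\<^sup>2)"
      using k0[OF True] e by (intro mult_mono power_mono) auto
    also have "\<dots> \<le> (2/3) ^ 1 * exp (- \<kappa> * (real k)\<^sup>2)"
      using k by (intro mult_right_mono power_decreasing) auto
    finally have "((real k)\<^sup>2 * (9/10) ^ k) ^ k \<le> 2/3 * exp (- \<kappa> * (real k)\<^sup>2)" by simp
    with separated_patterns_large[OF k] show ?thesis by (blast intro: separated_family_mono)
  next
    case False
    have "\<kappa> * (real k)\<^sup>2 \<le> \<kappa> * (real k0 + 1)\<^sup>2"
      using False \<kappa>(1) by (intro mult_left_mono power_mono) auto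
    also have "\<dots> \<le> ln (4/3)" using \<kappa>(3) by (simp add: field_simps)
    finally have "exp (- ln (4/3)) \<le> exp (- \<kappa> * (real k)\<^sup>2)" by simp
    moreover have "exp (- ln (4/3)) = (3/4 :: real)" by (simp add: exp_minus)
    ultimately have "1/2 \<le> 2/3 * exp (- \<kappa> * (real k)\<^sup>2)" by linarith
    with separated_patterns_constant[OF k] show ?thesis by (blast intro: separated_family_mono)
  qed
  with \<kappa>(1) show ?thesis by (intro exI[of _ \<kappa>]) simp
qed

section \<open>A triangle inequality for the distance\<close>

lemma nn_integral_unit_pair_product:
  assumes [measurable]: "F \<in> borel_measurable unit_leb" "G \<in> borel_measurable unit_leb"
  shows "(\<integral>\<^sup>+z. F (fst z) * G (snd z) \<partial>(unit_leb \<Otimes>\<^sub>M unit_leb))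
       = (\<integral>\<^sup>+x. F x \<partial>unit_leb) * (\<integral>\<^sup>+x. G x \<partial>unit_leb)"
proof -
  have "(\<integral>\<^sup>+z. F (fst z) * G (snd z) \<partial>(unit_leb \<Otimes>\<^sub>M unit_leb))
      = (\<integral>\<^sup>+x. \<integral>\<^sup>+y. F x * G y \<partial>unit_leb \<partial>unit_leb)"
    using unit_leb.nn_integral_fst[of "\<lambda>z. F (fst z) * G (snd z)" unit_leb] by simp
  also have "\<dots> = (\<integral>\<^sup>+x. F x * (\<integral>\<^sup>+y. G y \<partial>unit_leb) \<partial>unit_leb)"
    by (intro nn_integral_cong nn_integral_cmult) simp
  also have "\<dots> = (\<integral>\<^sup>+x. F x \<partial>unit_leb) * (\<integral>\<^sup>+x. G x \<partial>unit_leb)"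
    by (rule nn_integral_multc) simp
  finally show ?thesis .
qed

lemma AE_unit_pair:
  assumes "AE x in unit_leb. P x" "{x \<in> space unit_leb. P x} \<in> sets unit_leb"
  shows "AE z in unit_leb \<Otimes>\<^sub>M unit_leb. P (fst z)" "AE z in unit_leb \<Otimes>\<^sub>M unit_leb. P (snd z)"
proof -
  have [measurable]: "Measurable.pred unit_leb P" using assms(2) by (simp add: pred_def)
  show "AE z in unit_leb \<Otimes>\<^sub>M unit_leb. P (fst z)"
  proof (rule unit_pair.AE_pair_measure)
    show "{z \<in> space (unit_leb \<Otimes>\<^sub>M unit_leb). P (fst z)} \<in> sets (unit_leb \<Otimes>\<^sub>M unit_leb)"
      by measurable
    show "AE x in unit_leb. AE y in unit_leb. P (fst (x, y))"
      using assms(1) by eventually_elim simp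
  qed
  show "AE z in unit_leb \<Otimes>\<^sub>M unit_leb. P (snd z)"
  proof (rule unit_pair.AE_pair_measure)
    show "{z \<in> space (unit_leb \<Otimes>\<^sub>M unit_leb). P (snd z)} \<in> sets (unit_leb \<Otimes>\<^sub>M unit_leb)"
      by measurable
    show "AE x in unit_leb. AE y in unit_leb. P (snd (x, y))"
      using assms(1) by simp
  qed
qed

text \<open>
  A triangle inequality without inverting or composing maps. Two fractional partitions of the same
  interval have the common refinement \<open>f a * g a'\<close>, whose masses \<open>\<pi> a a'\<close> couple the two sets of
  blocks. On each cell the squared difference of the two levels is at most twice the sum of the
  squared differences to the intermediate function, and summing out the shares of the other
  partition, which add up to one, leaves the two original errors.
\<close>

lemma coupling_triangle:
  fixes V' :: "real \<times> real \<Rightarrow> real" and B B' :: "nat \<Rightarrow> nat \<Rightarrow> real"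
  assumes f: "fractional_partition k f" and g: "fractional_partition k g"
    and V' [measurable]: "V' \<in> borel_measurable (unit_leb \<Otimes>\<^sub>M unit_leb)"
  defines "\<pi> \<equiv> \<lambda>a a'. \<integral>\<^sup>+x. f a x * g a' x \<partial>unit_leb"
  shows "\<And>a. a < k \<Longrightarrow> (\<Sum>a'<k. \<pi> a a') = ennreal (1 / real k)"
    and "(\<Sum>a<k. \<Sum>a'<k. \<Sum>b<k. \<Sum>b'<k. \<pi> a a' * \<pi> b b' * ennreal ((B a b - B' a' b')\<^sup>2))
      \<le> 2 * (\<Sum>a<k. \<Sum>b<k. \<integral>\<^sup>+z. f a (fst z) * f b (snd z) * ennreal ((V' z - B a b)\<^sup>2) \<partial>(unit_leb \<Otimes>\<^sub>M unit_leb))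
      + 2 * (\<Sum>a<k. \<Sum>b<k. \<integral>\<^sup>+z. g a (fst z) * g b (snd z) * ennreal ((V' z - B' a b)\<^sup>2) \<partial>(unit_leb \<Otimes>\<^sub>M unit_leb))"
proof -
  let ?P = "unit_leb \<Otimes>\<^sub>M unit_leb"
  have fm [measurable]: "\<And>a. f a \<in> borel_measurable unit_leb" and fk: "\<And>a. a < k \<Longrightarrow> (\<integral>\<^sup>+x. f a x \<partial>unit_leb) = ennreal (1 / real k)"
    and f1: "AE x in unit_leb. (\<Sum>a<k. f a x) = 1"
    using f by (auto simp: fractional_partition_def)
  have gm [measurable]: "\<And>a. g a \<in> borel_measurable unit_leb"
    and g1: "AE x in unit_leb. (\<Sum>a<k. g a x) = 1"
    using g by (auto simp: fractional_partition_def)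
  show "(\<Sum>a'<k. \<pi> a a') = ennreal (1 / real k)" if "a < k" for a
  proof -
    have "(\<Sum>a'<k. \<pi> a a') = (\<integral>\<^sup>+x. (\<Sum>a'<k. f a x * g a' x) \<partial>unit_leb)"
      unfolding \<pi>_def by (intro nn_integral_sum[symmetric]) simp
    also have "\<dots> = (\<integral>\<^sup>+x. f a x \<partial>unit_leb)"
      using g1 by (intro nn_integral_cong_AE, eventually_elim) (simp add: sum_distrib_left[symmetric])
    finally show ?thesis using fk[OF that] by simp
  qed
  have "{x \<in> space unit_leb. (\<Sum>a<k. f a x) = 1} \<in> sets unit_leb"
       "{x \<in> space unit_leb. (\<Sum>a<k. g a x) = 1} \<in> sets unit_leb"
    by measurable
  note AE = AE_unit_pair[OF f1 this(1)] AE_unit_pair[OF g1 this(2)]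
  let ?w = "\<lambda>a a' b b' z. (f a (fst z) * g a' (fst z)) * (f b (snd z) * g b' (snd z))"
  let ?H = "\<lambda>a b z. ennreal ((V' z - B a b)\<^sup>2)" and ?H' = "\<lambda>a b z. ennreal ((V' z - B' a b)\<^sup>2)"
  have summand: "\<pi> a a' * \<pi> b b' * ennreal ((B a b - B' a' b')\<^sup>2)
      \<le> (\<integral>\<^sup>+z. ?w a a' b b' z * (2 * ?H a b z + 2 * ?H' a' b' z) \<partial>?P)"
    if "a < k" "a' < k" "b < k" "b' < k" for a a' b b'
  proof -
    have "\<pi> a a' * \<pi> b b' = (\<integral>\<^sup>+z. ?w a a' b b' z \<partial>?P)"
      unfolding \<pi>_def by (intro nn_integral_unit_pair_product[symmetric]) measurable
    then have "\<pi> a a' * \<pi> b b' * ennreal ((B a b - B' a' b')\<^sup>2) = (\<integral>\<^sup>+z. ?w a a' b b' z * ennreal ((B a b - B' a' b')\<^sup>2) \<partial>?P)"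
      by (simp only:) (rule nn_integral_multc[symmetric], measurable)
    also have "\<dots> \<le> (\<integral>\<^sup>+z. ?w a a' b b' z * (2 * ?H a b z + 2 * ?H' a' b' z) \<partial>?P)"
    proof (intro nn_integral_mono mult_left_mono)
      fix z
      have "(B a b - B' a' b')\<^sup>2 \<le> 2 * (V' z - B a b)\<^sup>2 + 2 * (V' z - B' a' b')\<^sup>2"
        using sum_squares_bound[of "V' z - B a b" "- (V' z - B' a' b')"]
        by (simp add: power2_eq_square algebra_simps)
      then have "ennreal ((B a b - B' a' b')\<^sup>2) \<le> ennreal (2 * (V' z - B a b)\<^sup>2 + 2 * (V' z - B' a' b')\<^sup>2)"
        by (rule ennreal_leI)
      then show "ennreal ((B a b - B' a' b')\<^sup>2) \<le> 2 * ?H a b z + 2 * ?H' a' b' z"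
        by (simp add: ennreal_plus ennreal_mult)
    qed simp
    finally show ?thesis .
  qed
  have "(\<Sum>a<k. \<Sum>a'<k. \<Sum>b<k. \<Sum>b'<k. \<pi> a a' * \<pi> b b' * ennreal ((B a b - B' a' b')\<^sup>2))
      \<le> (\<Sum>a<k. \<Sum>a'<k. \<Sum>b<k. \<Sum>b'<k. \<integral>\<^sup>+z. ?w a a' b b' z * (2 * ?H a b z + 2 * ?H' a' b' z) \<partial>?P)"
    by (intro sum_mono summand) auto
  also have "\<dots> = (\<integral>\<^sup>+z. (\<Sum>a<k. \<Sum>a'<k. \<Sum>b<k. \<Sum>b'<k. ?w a a' b b' z * (2 * ?H a b z + 2 * ?H' a' b' z)) \<partial>?P)"
  proof -
    define Q where "Q a a' b b' = (\<lambda>z. ?w a a' b b' z * (2 * ?H a b z + 2 * ?H' a' b' z))" for a a' b b'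
    have [measurable]: "Q a a' b b' \<in> borel_measurable ?P" for a a' b b'
      unfolding Q_def by measurable
    have "(\<Sum>a<k. \<Sum>a'<k. \<Sum>b<k. \<Sum>b'<k. \<integral>\<^sup>+z. Q a a' b b' z \<partial>?P)
        = (\<integral>\<^sup>+z. (\<Sum>a<k. \<Sum>a'<k. \<Sum>b<k. \<Sum>b'<k. Q a a' b b' z) \<partial>?P)"
      by (simp add: nn_integral_sum)
    then show ?thesis unfolding Q_def .
  qed
  also have "\<dots> = (\<integral>\<^sup>+z. 2 * (\<Sum>a<k. \<Sum>b<k. f a (fst z) * f b (snd z) * ?H a b z)
                      + 2 * (\<Sum>a<k. \<Sum>b<k. g a (fst z) * g b (snd z) * ?H' a b z) \<partial>?P)"
  proof (rule nn_integral_cong_AE)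
    show "AE z in ?P. (\<Sum>a<k. \<Sum>a'<k. \<Sum>b<k. \<Sum>b'<k. ?w a a' b b' z * (2 * ?H a b z + 2 * ?H' a' b' z))
        = 2 * (\<Sum>a<k. \<Sum>b<k. f a (fst z) * f b (snd z) * ?H a b z)
        + 2 * (\<Sum>a<k. \<Sum>b<k. g a (fst z) * g b (snd z) * ?H' a b z)"
      using AE
    proof eventually_elim
      case (elim z)
      let ?f = "\<lambda>a. f a (fst z)" and ?f' = "\<lambda>a. f a (snd z)" and ?g = "\<lambda>a. g a (fst z)" and ?g' = "\<lambda>a. g a (snd z)"
      have 1: "(\<Sum>a<k. \<Sum>a'<k. \<Sum>b<k. \<Sum>b'<k. ?w a a' b b' z * (2 * ?H a b z)) = 2 * (\<Sum>a<k. \<Sum>b<k. ?f a * ?f' b * ?H a b z)"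
      proof -
        have "(\<Sum>a<k. \<Sum>a'<k. \<Sum>b<k. \<Sum>b'<k. ?w a a' b b' z * (2 * ?H a b z))
            = (\<Sum>a<k. \<Sum>a'<k. \<Sum>b<k. ?g a' * (2 * (?f a * ?f' b * ?H a b z)) * (\<Sum>b'<k. ?g' b'))"
          unfolding sum_distrib_left by (intro sum.cong refl) (simp only: mult_ac)
        also have "\<dots> = (\<Sum>a<k. \<Sum>a'<k. ?g a' * (\<Sum>b<k. 2 * (?f a * ?f' b * ?H a b z)))"
          using elim by (simp add: sum_distrib_left)
        also have "\<dots> = (\<Sum>a<k. \<Sum>b<k. 2 * (?f a * ?f' b * ?H a b z))"
          unfolding sum_distrib_right[symmetric] using elim by simp
        finally show ?thesis by (simp add: sum_distrib_left)
      qed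
      have 2: "(\<Sum>a<k. \<Sum>a'<k. \<Sum>b<k. \<Sum>b'<k. ?w a a' b b' z * (2 * ?H' a' b' z)) = 2 * (\<Sum>a<k. \<Sum>b<k. ?g a * ?g' b * ?H' a b z)"
      proof -
        have "(\<Sum>a<k. \<Sum>a'<k. \<Sum>b<k. \<Sum>b'<k. ?w a a' b b' z * (2 * ?H' a' b' z))
            = (\<Sum>a<k. \<Sum>a'<k. \<Sum>b<k. ?f' b * (?f a * (\<Sum>b'<k. 2 * (?g a' * ?g' b' * ?H' a' b' z))))"
          unfolding sum_distrib_left by (intro sum.cong refl) (simp only: mult_ac)
        also have "\<dots> = (\<Sum>a<k. \<Sum>a'<k. ?f a * (\<Sum>b'<k. 2 * (?g a' * ?g' b' * ?H' a' b' z)))"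
          unfolding sum_distrib_right[symmetric] using elim by simp
        also have "\<dots> = (\<Sum>a<k. ?f a * (\<Sum>a'<k. \<Sum>b'<k. 2 * (?g a' * ?g' b' * ?H' a' b' z)))"
          by (simp add: sum_distrib_left)
        also have "\<dots> = (\<Sum>a'<k. \<Sum>b'<k. 2 * (?g a' * ?g' b' * ?H' a' b' z))"
          unfolding sum_distrib_right[symmetric] using elim by simp
        finally show ?thesis by (simp add: sum_distrib_left)
      qed
      show ?case
        unfolding distrib_left sum.distrib 1 2 ..
    qed
  qed
  also have "\<dots> = 2 * (\<Sum>a<k. \<Sum>b<k. \<integral>\<^sup>+z. f a (fst z) * f b (snd z) * ?H a b z \<partial>?P)
      + 2 * (\<Sum>a<k. \<Sum>b<k. \<integral>\<^sup>+z. g a (fst z) * g b (snd z) * ?H' a b z \<partial>?P)"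
  proof -
    define F where "F a b = (\<lambda>z. f a (fst z) * f b (snd z) * ?H a b z)" for a b
    define G where "G a b = (\<lambda>z. g a (fst z) * g b (snd z) * ?H' a b z)" for a b
    have [measurable]: "F a b \<in> borel_measurable ?P" "G a b \<in> borel_measurable ?P" for a b
      unfolding F_def G_def by measurable
    have "(\<integral>\<^sup>+z. 2 * (\<Sum>a<k. \<Sum>b<k. F a b z) + 2 * (\<Sum>a<k. \<Sum>b<k. G a b z) \<partial>?P)
        = 2 * (\<Sum>a<k. \<Sum>b<k. \<integral>\<^sup>+z. F a b z \<partial>?P) + 2 * (\<Sum>a<k. \<Sum>b<k. \<integral>\<^sup>+z. G a b z \<partial>?P)"
      by (simp add: nn_integral_add nn_integral_cmult nn_integral_sum)
    then show ?thesis unfolding F_def G_def .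
  qed
  finally show "(\<Sum>a<k. \<Sum>a'<k. \<Sum>b<k. \<Sum>b'<k. \<pi> a a' * \<pi> b b' * ennreal ((B a b - B' a' b')\<^sup>2))
      \<le> 2 * (\<Sum>a<k. \<Sum>b<k. \<integral>\<^sup>+z. f a (fst z) * f b (snd z) * ?H a b z \<partial>?P)
      + 2 * (\<Sum>a<k. \<Sum>b<k. \<integral>\<^sup>+z. g a (fst z) * g b (snd z) * ?H' a b z \<partial>?P)" .
qed

lemma identity_measure_preserving: "(\<lambda>x. x) \<in> measure_preserving_maps"
  unfolding measure_preserving_maps_def mem_Collect_eq
  by (intro conjI measurable_ident_sets refl distr_id)

lemma l2_norm_nonneg: "0 \<le> l2_norm U"
  unfolding l2_norm_def by (intro real_sqrt_ge_zero integral_nonneg_AE AE_I2) (auto simp: split_beta)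

text \<open>
  By the triangle inequality the coupled patterns differ on a set of mass less than a sixteenth:
  each squared error is below \<open>\<epsilon>\<^sup>2 / 16\<close>, whereas a disagreement of the patterns costs
  \<open>(2 * \<epsilon>)\<^sup>2\<close>. Rounding the coupling gives the two relabellings.
\<close>

lemma delta2_near_both_imp_nearly_matches:
  assumes V: "graphon V" and k: "1 \<le> k" and \<epsilon>: "0 < \<epsilon>"
    and W: "graphon (pattern_graphon p \<epsilon> k s)" "graphon (pattern_graphon p \<epsilon> k s')"
    and close: "delta2 V (pattern_graphon p \<epsilon> k s) < \<epsilon> / 4" "delta2 V (pattern_graphon p \<epsilon> k s') < \<epsilon> / 4"
  shows "nearly_matches k s s'"
proof -
  let ?P = "unit_leb \<Otimes>\<^sub>M unit_leb"
  obtain V' where V': "V' \<in> borel_measurable borel"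
    and VV': "AE z in lborel. z \<in> {0..1} \<times> {0..1} \<longrightarrow> case_prod V z = V' z"
    using graphon_borel_version[OF V] by blast
  have V'P [measurable]: "V' \<in> borel_measurable ?P"
    using measurable_compose[OF measurable_unit_pair_borel V'] .
  have k0: "0 < k" using k by simp
  \<comment> \<open>A map achieving the distance turns the squared error into a sum over pairs of blocks.\<close>
  have key: "\<exists>f. fractional_partition k f \<and>
      (\<Sum>a<k. \<Sum>b<k. \<integral>\<^sup>+z. f a (fst z) * f b (snd z) * ennreal ((V' z - level p \<epsilon> t a b)\<^sup>2) \<partial>?P) < ennreal ((\<epsilon> / 4)\<^sup>2)"
    if t: "graphon (pattern_graphon p \<epsilon> k t)" "delta2 V (pattern_graphon p \<epsilon> k t) < \<epsilon> / 4" for t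
  proof -
    obtain \<phi> where \<phi>: "\<phi> \<in> measure_preserving_maps"
      and l: "l2_norm (\<lambda>x y. pullback V \<phi> x y - pattern_graphon p \<epsilon> k t x y) < \<epsilon> / 4"
      using cInf_lessD[OF _ t(2)[unfolded delta2_def]] identity_measure_preserving by blast
    obtain f where f: "fractional_partition k f"
      and fH: "\<And>H. (\<And>a b. H a b \<in> borel_measurable ?P) \<Longrightarrow>
      (\<integral>\<^sup>+z. H (block_index k (fst z)) (block_index k (snd z)) (\<phi> (fst z), \<phi> (snd z)) \<partial>?P)
      = (\<Sum>a<k. \<Sum>b<k. \<integral>\<^sup>+z. f a (fst z) * f b (snd z) * H a b z \<partial>?P)"
      using fractional_partition_of_map[OF \<phi> k0] by blast
    have "(\<Sum>a<k. \<Sum>b<k. \<integral>\<^sup>+z. f a (fst z) * f b (snd z) * ennreal ((V' z - level p \<epsilon> t a b)\<^sup>2) \<partial>?P)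
      = ennreal ((l2_norm (\<lambda>x y. pullback V \<phi> x y - pattern_graphon p \<epsilon> k t x y))\<^sup>2)"
      unfolding l2_norm_pullback_diff[OF V V' VV' measurable_pattern_graphon t(1) \<phi>]
      by (subst fH[symmetric]) (auto simp: pattern_graphon_def)
    also have "\<dots> < ennreal ((\<epsilon> / 4)\<^sup>2)"
      using l \<epsilon> l2_norm_nonneg by (intro ennreal_lessI power_strict_mono) auto
    finally show ?thesis using f by blast
  qed
  obtain f where f: "fractional_partition k f"
    and fs: "(\<Sum>a<k. \<Sum>b<k. \<integral>\<^sup>+z. f a (fst z) * f b (snd z) * ennreal ((V' z - level p \<epsilon> s a b)\<^sup>2) \<partial>?P) < ennreal ((\<epsilon> / 4)\<^sup>2)"
    using key[OF W(1) close(1)] by blast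
  obtain g where g: "fractional_partition k g"
    and gs: "(\<Sum>a<k. \<Sum>b<k. \<integral>\<^sup>+z. g a (fst z) * g b (snd z) * ennreal ((V' z - level p \<epsilon> s' a b)\<^sup>2) \<partial>?P) < ennreal ((\<epsilon> / 4)\<^sup>2)"
    using key[OF W(2) close(2)] by blast
  define c where "c a b a' b' = (level p \<epsilon> s a b - level p \<epsilon> s' a' b')\<^sup>2" for a b a' b'
  note tri = coupling_triangle[OF f g V'P]
  obtain \<sigma> \<tau> where \<sigma>: "\<sigma> \<in> {..<k} \<rightarrow> {..<k}" and \<tau>: "\<tau> \<in> {..<k} \<rightarrow> {..<k}"
    and le: "(\<Sum>a<k. \<Sum>b<k. ennreal (1 / real k) * ennreal (1 / real k) * ennreal (c a b (\<sigma> a) (\<tau> b)))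
       \<le> (\<Sum>a<k. \<Sum>a'<k. \<Sum>b<k. \<Sum>b'<k. (\<integral>\<^sup>+x. f a x * g a' x \<partial>unit_leb) * (\<integral>\<^sup>+x. f b x * g b' x \<partial>unit_leb) * ennreal (c a b a' b'))"
    using round_coupling[where \<pi>="\<lambda>a a'. \<integral>\<^sup>+x. f a x * g a' x \<partial>unit_leb"
          and K="ennreal (1 / real k)" and c="\<lambda>a b a' b'. ennreal (c a b a' b')", OF k0 tri(1)] by blast
  let ?D = "{(a, b). a < k \<and> b < k \<and> s a b \<noteq> s' (\<sigma> a) (\<tau> b)}"
  have "(\<Sum>a<k. \<Sum>b<k. ennreal (1 / real k) * ennreal (1 / real k) * ennreal (c a b (\<sigma> a) (\<tau> b)))
      = ennreal (\<Sum>a<k. \<Sum>b<k. 1 / real k * (1 / real k) * c a b (\<sigma> a) (\<tau> b))"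
    by (simp add: sum_ennreal[symmetric] sum_nonneg c_def ennreal_mult[symmetric] del: sum_ennreal)
  also have "(\<Sum>a<k. \<Sum>b<k. 1 / real k * (1 / real k) * c a b (\<sigma> a) (\<tau> b)) = 4 * \<epsilon>\<^sup>2 / (real k)\<^sup>2 * real (card ?D)"
  proof -
    have fin: "finite ({..<k} \<times> {..<k})" by simp
    have "(\<Sum>a<k. \<Sum>b<k. 1 / real k * (1 / real k) * c a b (\<sigma> a) (\<tau> b))
        = (\<Sum>z\<in>{..<k} \<times> {..<k}. 1 / real k * (1 / real k) * c (fst z) (snd z) (\<sigma> (fst z)) (\<tau> (snd z)))"
      by (simp add: sum.cartesian_product split_beta')
    also have "\<dots> = (\<Sum>z\<in>{..<k} \<times> {..<k}. if z \<in> ?D then 4 * \<epsilon>\<^sup>2 / (real k)\<^sup>2 else 0)"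
      by (intro sum.cong) (auto simp: c_def level_def power2_eq_square)
    also have "\<dots> = (\<Sum>z\<in>({..<k} \<times> {..<k}) \<inter> ?D. 4 * \<epsilon>\<^sup>2 / (real k)\<^sup>2)"
      by (rule sum.inter_restrict[OF fin, symmetric])
    also have "({..<k} \<times> {..<k}) \<inter> ?D = ?D" by auto
    finally show ?thesis by simp
  qed
  finally have "ennreal (4 * \<epsilon>\<^sup>2 / (real k)\<^sup>2 * real (card ?D))
      = (\<Sum>a<k. \<Sum>b<k. ennreal (1 / real k) * ennreal (1 / real k) * ennreal (c a b (\<sigma> a) (\<tau> b)))" by simp
  also note le
  also note tri(2)[where B="level p \<epsilon> s" and B'="level p \<epsilon> s'", folded c_def]
  also have "2 * (\<Sum>a<k. \<Sum>b<k. \<integral>\<^sup>+z. f a (fst z) * f b (snd z) * ennreal ((V' z - level p \<epsilon> s a b)\<^sup>2) \<partial>?P)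
      + 2 * (\<Sum>a<k. \<Sum>b<k. \<integral>\<^sup>+z. g a (fst z) * g b (snd z) * ennreal ((V' z - level p \<epsilon> s' a b)\<^sup>2) \<partial>?P)
      < 2 * ennreal ((\<epsilon> / 4)\<^sup>2) + 2 * ennreal ((\<epsilon> / 4)\<^sup>2)"
    using fs gs by (intro add_strict_mono ennreal_mult_strict_left_mono) auto
  also have "2 * ennreal ((\<epsilon> / 4)\<^sup>2) + 2 * ennreal ((\<epsilon> / 4)\<^sup>2) = ennreal (\<epsilon>\<^sup>2 / 4)"
  proof -
    have "2 * ennreal ((\<epsilon> / 4)\<^sup>2) = ennreal (\<epsilon>\<^sup>2 / 8)"
      by (simp add: ennreal_numeral[symmetric] ennreal_mult[symmetric] power2_eq_square del: ennreal_numeral)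
    then have "2 * ennreal ((\<epsilon> / 4)\<^sup>2) + 2 * ennreal ((\<epsilon> / 4)\<^sup>2) = ennreal (\<epsilon>\<^sup>2 / 8) + ennreal (\<epsilon>\<^sup>2 / 8)" by simp
    also have "\<dots> = ennreal (\<epsilon>\<^sup>2 / 8 + \<epsilon>\<^sup>2 / 8)" by (rule ennreal_plus[symmetric]) auto
    also have "\<epsilon>\<^sup>2 / 8 + \<epsilon>\<^sup>2 / 8 = \<epsilon>\<^sup>2 / 4" by simp
    finally show ?thesis .
  qed
  finally have "4 * \<epsilon>\<^sup>2 / (real k)\<^sup>2 * real (card ?D) < \<epsilon>\<^sup>2 / 4"
    by (simp add: ennreal_less_iff)
  then have "16 * real (card ?D) < (real k)\<^sup>2"
    using k \<epsilon> by (simp add: field_simps)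
  then have "real (16 * card ?D) < real (k\<^sup>2)" by simp
  then have lt: "16 * card ?D < k\<^sup>2" by (simp only: of_nat_less_iff)
  have "{(a, b). a < k \<and> b < k \<and> s a b \<noteq> s' (restrict \<sigma> {..<k} a) (restrict \<tau> {..<k} b)} = ?D"
    by auto
  then show ?thesis
    unfolding nearly_matches_def using \<sigma> \<tau> lt
    by (intro bexI[of _ "restrict \<sigma> {..<k}"] bexI[of _ "restrict \<tau> {..<k}"]) (auto simp: Pi_iff)
qed

section \<open>Likelihood ratios of independent edges\<close>

text \<open>
  The probability that exactly the elements of \<open>A\<close> are chosen when each \<open>e\<close> in \<open>E\<close> is chosen
  independently with probability \<open>q e\<close>.
\<close>

definition bernoulli_weight :: "'e set \<Rightarrow> ('e \<Rightarrow> real) \<Rightarrow> 'e set \<Rightarrow> real" where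
  "bernoulli_weight E q A = (\<Prod>e\<in>A. q e) * (\<Prod>e\<in>E - A. 1 - q e)"

lemma sum_bernoulli_weight: "finite E \<Longrightarrow> (\<Sum>A\<in>Pow E. bernoulli_weight E q A) = 1"
  unfolding bernoulli_weight_def by (subst prod_add[symmetric]) auto

lemma bernoulli_weight_nonneg:
  assumes "\<And>e. e \<in> E \<Longrightarrow> 0 \<le> q e \<and> q e \<le> 1" "A \<subseteq> E"
  shows "0 \<le> bernoulli_weight E q A"
  unfolding bernoulli_weight_def using assms by (intro mult_nonneg_nonneg prod_nonneg) auto

text \<open>
  One plus the chi-square divergence from the homogeneous model with edge probability \<open>p\<close>. It
  factorises over the independent edges, each contributing \<open>1 + (q e - p)\<^sup>2 / (p * (1 - p))\<close>.
\<close>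

lemma second_moment_likelihood_ratio:
  assumes E: "finite E" and p: "0 < p" "p < 1" and q: "\<And>e. e \<in> E \<Longrightarrow> \<bar>q e - p\<bar> \<le> \<epsilon>"
  shows "(\<Sum>A\<in>Pow E. (bernoulli_weight E q A)\<^sup>2 / bernoulli_weight E (\<lambda>_. p) A)
       \<le> exp (real (card E) * (\<epsilon>\<^sup>2 / (p * (1 - p))))"
proof -
  have "(\<Sum>A\<in>Pow E. (bernoulli_weight E q A)\<^sup>2 / bernoulli_weight E (\<lambda>_. p) A)
      = (\<Sum>A\<in>Pow E. (\<Prod>e\<in>A. (q e)\<^sup>2 / p) * (\<Prod>e\<in>E - A. (1 - q e)\<^sup>2 / (1 - p)))"
    by (simp add: bernoulli_weight_def power_mult_distrib prod_power_distrib prod_dividef)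
  also have "\<dots> = (\<Prod>e\<in>E. (q e)\<^sup>2 / p + (1 - q e)\<^sup>2 / (1 - p))"
    by (rule prod_add[OF E, symmetric])
  also have "\<dots> \<le> (\<Prod>e\<in>E. exp (\<epsilon>\<^sup>2 / (p * (1 - p))))"
  proof (intro prod_mono conjI)
    fix e assume e: "e \<in> E"
    show "0 \<le> (q e)\<^sup>2 / p + (1 - q e)\<^sup>2 / (1 - p)" using p by simp
    have "(q e)\<^sup>2 / p + (1 - q e)\<^sup>2 / (1 - p) = 1 + (q e - p)\<^sup>2 / (p * (1 - p))"
      using p by (simp add: field_simps power2_eq_square)
    also have "\<dots> \<le> 1 + \<epsilon>\<^sup>2 / (p * (1 - p))"
      using p power_mono[OF q[OF e], of 2] by (intro add_left_mono divide_right_mono) auto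
    also have "\<dots> \<le> exp (\<epsilon>\<^sup>2 / (p * (1 - p)))" by (rule exp_ge_add_one_self)
    finally show "(q e)\<^sup>2 / p + (1 - q e)\<^sup>2 / (1 - p) \<le> exp (\<epsilon>\<^sup>2 / (p * (1 - p)))" .
  qed
  also have "\<dots> = exp (real (card E) * (\<epsilon>\<^sup>2 / (p * (1 - p))))"
    by (simp only: prod_constant exp_of_nat_mult)
  finally show ?thesis .
qed

text \<open>
  Think of \<open>N A s\<close> as the event that the observation \<open>A\<close> identifies the uniformly random hypothesis
  \<open>s\<close>. Under the homogeneous model \<open>A\<close> carries no information on \<open>s\<close>, so there the event has
  probability at most \<open>\<beta>\<close>. The Cauchy-Schwarz inequality changes from that model to the true one, at
  the cost of the second moment of the likelihood ratio.
\<close>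

lemma identification_probability_bound:
  fixes q :: "'s \<Rightarrow> 'e \<Rightarrow> real"
  assumes E: "finite E" and S: "finite S" and p: "0 < p" "p < 1"
    and q: "\<And>s e. s \<in> S \<Longrightarrow> e \<in> E \<Longrightarrow> \<bar>q s e - p\<bar> \<le> \<epsilon>"
    and near: "\<And>A. A \<subseteq> E \<Longrightarrow> real (card {s \<in> S. N A s}) \<le> \<beta> * real (card S)"
  shows "(\<Sum>s\<in>S. \<Sum>A | A \<in> Pow E \<and> N A s. bernoulli_weight E (q s) A)
       \<le> real (card S) * sqrt (\<beta> * exp (real (card E) * (\<epsilon>\<^sup>2 / (p * (1 - p)))))"
proof -
  let ?P = "\<lambda>s. bernoulli_weight E (q s)" and ?Q = "bernoulli_weight E (\<lambda>_. p)"
  let ?\<chi> = "exp (real (card E) * (\<epsilon>\<^sup>2 / (p * (1 - p))))"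
  let ?i = "\<lambda>A s. if N A s then 1 else 0 :: real"
  have Q: "0 < ?Q A" for A
    using p by (simp add: bernoulli_weight_def)
  have fin: "finite (Pow E)" using E by simp
  \<comment> \<open>The factors to which the Cauchy-Schwarz inequality applies: the squares of the first ones sum
    to the second moments, those of the second ones to a probability under the homogeneous model.\<close>
  have eq: "(\<Sum>s\<in>S. \<Sum>A | A \<in> Pow E \<and> N A s. ?P s A) = (\<Sum>(s, A)\<in>S \<times> Pow E. (?P s A / sqrt (?Q A)) * (sqrt (?Q A) * ?i A s))"
  proof -
    have "(\<Sum>A | A \<in> Pow E \<and> N A s. ?P s A) = (\<Sum>A\<in>Pow E. (?P s A / sqrt (?Q A)) * (sqrt (?Q A) * ?i A s))" for s
    proof -
      have "(\<Sum>A | A \<in> Pow E \<and> N A s. ?P s A) = (\<Sum>A\<in>Pow E. if N A s then ?P s A else 0)"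
        by (rule sum.inter_filter[OF fin])
      also have "\<dots> = (\<Sum>A\<in>Pow E. (?P s A / sqrt (?Q A)) * (sqrt (?Q A) * ?i A s))"
        using Q by (intro sum.cong) (auto simp: less_imp_neq[symmetric])
      finally show ?thesis .
    qed
    then show ?thesis by (simp add: sum.cartesian_product)
  qed
  have "(\<Sum>(s, A)\<in>S \<times> Pow E. (?P s A / sqrt (?Q A)) * (sqrt (?Q A) * ?i A s))\<^sup>2
      \<le> (\<Sum>(s, A)\<in>S \<times> Pow E. (?P s A / sqrt (?Q A))\<^sup>2) * (\<Sum>(s, A)\<in>S \<times> Pow E. (sqrt (?Q A) * ?i A s)\<^sup>2)"
    using Cauchy_Schwarz_ineq_sum[of "\<lambda>(s, A). ?P s A / sqrt (?Q A)" "\<lambda>(s, A). sqrt (?Q A) * ?i A s" "S \<times> Pow E"]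
    by (simp add: split_beta)
  also have "\<dots> \<le> (real (card S) * ?\<chi>) * (\<beta> * real (card S))"
  proof (intro mult_mono)
    have "(\<Sum>(s, A)\<in>S \<times> Pow E. (?P s A / sqrt (?Q A))\<^sup>2) = (\<Sum>s\<in>S. \<Sum>A\<in>Pow E. (?P s A)\<^sup>2 / ?Q A)"
      using Q by (simp add: sum.cartesian_product[symmetric] power_divide less_imp_le)
    also have "\<dots> \<le> (\<Sum>s\<in>S. ?\<chi>)"
      by (intro sum_mono second_moment_likelihood_ratio[OF E p q])
    finally show "(\<Sum>(s, A)\<in>S \<times> Pow E. (?P s A / sqrt (?Q A))\<^sup>2) \<le> real (card S) * ?\<chi>" by simp
    have "(\<Sum>(s, A)\<in>S \<times> Pow E. (sqrt (?Q A) * ?i A s)\<^sup>2) = (\<Sum>A\<in>Pow E. \<Sum>s\<in>S. (sqrt (?Q A) * ?i A s)\<^sup>2)"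
      by (simp only: sum.cartesian_product[symmetric]) (rule sum.swap)
    also have "\<dots> = (\<Sum>A\<in>Pow E. ?Q A * real (card {s \<in> S. N A s}))"
    proof (intro sum.cong refl)
      fix A
      have "(\<Sum>s\<in>S. (sqrt (?Q A) * ?i A s)\<^sup>2) = (\<Sum>s\<in>S. if N A s then ?Q A else 0)"
        using Q[of A] by (intro sum.cong) auto
      also have "\<dots> = (\<Sum>s | s \<in> S \<and> N A s. ?Q A)" by (rule sum.inter_filter[OF S, symmetric])
      finally show "(\<Sum>s\<in>S. (sqrt (?Q A) * ?i A s)\<^sup>2) = ?Q A * real (card {s \<in> S. N A s})" by simp
    qed
    also have "\<dots> \<le> (\<Sum>A\<in>Pow E. ?Q A * (\<beta> * real (card S)))"
      using Q near by (intro sum_mono mult_left_mono) (auto intro: less_imp_le)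
    also have "\<dots> = \<beta> * real (card S)"
      by (simp add: sum_distrib_right[symmetric] sum_bernoulli_weight[OF E])
    finally show "(\<Sum>(s, A)\<in>S \<times> Pow E. (sqrt (?Q A) * ?i A s)\<^sup>2) \<le> \<beta> * real (card S)" .
  qed (auto intro!: sum_nonneg)
  also have "\<dots> = (real (card S))\<^sup>2 * (\<beta> * ?\<chi>)" by (simp add: power2_eq_square)
  finally have "sqrt ((\<Sum>s\<in>S. \<Sum>A | A \<in> Pow E \<and> N A s. ?P s A)\<^sup>2) \<le> sqrt ((real (card S))\<^sup>2 * (\<beta> * ?\<chi>))"
    unfolding eq by (rule real_sqrt_le_mono)
  then have "\<bar>\<Sum>s\<in>S. \<Sum>A | A \<in> Pow E \<and> N A s. ?P s A\<bar> \<le> real (card S) * sqrt (\<beta> * ?\<chi>)"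
    by (simp only: real_sqrt_abs real_sqrt_mult abs_of_nat)
  then show ?thesis by (rule order_trans[OF abs_ge_self])
qed

definition edges :: "(nat \<times> nat) set \<Rightarrow> graph" where
  "edges A = {{i, j} | i j. (i, j) \<in> A}"

lemma finite_node_pairs: "finite (node_pairs n)"
  by (rule finite_subset[of _ "{..<n} \<times> {..<n}"]) (auto simp: node_pairs_def)

lemma card_node_pairs_le: "2 * card (node_pairs n) \<le> n\<^sup>2"
proof -
  have sub: "node_pairs n \<union> prod.swap ` node_pairs n \<subseteq> {..<n} \<times> {..<n}"
    by (auto simp: node_pairs_def)
  have "card (node_pairs n \<union> prod.swap ` node_pairs n) = card (node_pairs n) + card (prod.swap ` node_pairs n)"
    using finite_node_pairs by (intro card_Un_disjoint) (auto simp: node_pairs_def)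
  also have "card (prod.swap ` node_pairs n) = card (node_pairs n)" by (intro card_image) (auto simp: inj_on_def)
  finally have "2 * card (node_pairs n) = card (node_pairs n \<union> prod.swap ` node_pairs n)" by simp
  also have "\<dots> \<le> card ({..<n} \<times> {..<n})" using sub by (intro card_mono) auto
  finally show ?thesis by (simp add: power2_eq_square)
qed

lemma edges_in_graphs: "A \<subseteq> node_pairs n \<Longrightarrow> edges A \<in> graphs n"
  by (force simp: edges_def graphs_def node_pairs_def)

lemma expectation_graph_given_labels:
  fixes F :: "graph \<Rightarrow> real"
  assumes W: "\<And>i j. (i, j) \<in> node_pairs n \<Longrightarrow> 0 \<le> W (l i) (l j) \<and> W (l i) (l j) \<le> 1"
  shows "measure_pmf.expectation (graph_given_labels n W l) F
       = (\<Sum>A\<in>Pow (node_pairs n). bernoulli_weight (node_pairs n) (\<lambda>(i, j). W (l i) (l j)) A * F (edges A))"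
proof -
  let ?E = "node_pairs n" and ?q = "\<lambda>(i, j). W (l i) (l j)"
  let ?p = "Pi_pmf ?E False (\<lambda>(i, j). bernoulli_pmf (W (l i) (l j)))"
  let ?h = "\<lambda>b. {{i, j} | i j. (i, j) \<in> ?E \<and> b (i, j)}"
  let ?ind = "\<lambda>A e. e \<in> A"
  have inj: "inj_on ?ind (Pow ?E)" by (auto simp: inj_on_def fun_eq_iff)
  have "measure_pmf.expectation (graph_given_labels n W l) F = measure_pmf.expectation ?p (\<lambda>b. F (?h b))"
    unfolding graph_given_labels_def by (simp add: integral_map_pmf)
  also have "\<dots> = (\<Sum>b\<in>?ind ` Pow ?E. F (?h b) * pmf ?p b)"
  proof (rule integral_measure_pmf_real)
    show "finite (?ind ` Pow ?E)" using finite_node_pairs by simp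
    fix b assume b: "b \<in> set_pmf ?p"
    from subsetD[OF set_Pi_pmf_subset[OF finite_node_pairs] b]
    have "\<And>e. e \<notin> ?E \<Longrightarrow> \<not> b e" by blast
    then have "b = ?ind {e. b e}" "{e. b e} \<in> Pow ?E" by auto
    then show "b \<in> ?ind ` Pow ?E" by blast
  qed
  also have "\<dots> = (\<Sum>A\<in>Pow ?E. F (?h (?ind A)) * pmf ?p (?ind A))"
    by (simp add: sum.reindex[OF inj])
  also have "\<dots> = (\<Sum>A\<in>Pow ?E. bernoulli_weight ?E ?q A * F (edges A))"
  proof (intro sum.cong refl)
    fix A assume A: "A \<in> Pow ?E"
    have "?h (?ind A) = edges A" using A by (auto simp: edges_def)
    moreover have "pmf ?p (?ind A) = bernoulli_weight ?E ?q A"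
    proof -
      have "pmf ?p (?ind A) = (\<Prod>e\<in>?E. pmf (case e of (i, j) \<Rightarrow> bernoulli_pmf (W (l i) (l j))) (e \<in> A))"
        using A by (subst pmf_Pi'[OF finite_node_pairs]) auto
      also have "\<dots> = (\<Prod>e\<in>?E. if e \<in> A then ?q e else 1 - ?q e)"
        using W by (intro prod.cong) auto
      also have "\<dots> = (\<Prod>e\<in>?E \<inter> {e. e \<in> A}. ?q e) * (\<Prod>e\<in>?E \<inter> - {e. e \<in> A}. 1 - ?q e)"
        by (rule prod.If_cases[OF finite_node_pairs])
      also have "?E \<inter> {e. e \<in> A} = A" using A by auto
      also have "?E \<inter> - {e. e \<in> A} = ?E - A" by auto
      finally show ?thesis by (simp only: bernoulli_weight_def)
    qed
    ultimately show "F (?h (?ind A)) * pmf ?p (?ind A) = bernoulli_weight ?E ?q A * F (edges A)" by simp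
  qed
  finally show ?thesis .
qed

section \<open>The law of the random graph\<close>

lemma prob_space_label_product: "prob_space (\<Pi>\<^sub>M i\<in>{..<n}. unit_leb)"
  by (rule prob_space_PiM) (rule prob_space_unit_leb)

lemma prob_space_label_space: "prob_space (label_space n)"
  unfolding label_space_def by (rule prob_space.prob_space_completion[OF prob_space_label_product])

lemma label_space_range:
  "l \<in> space (label_space n) \<Longrightarrow> i < n \<Longrightarrow> l i \<in> {0..1}"
  unfolding label_space_def space_completion space_PiM
  by (drule PiE_mem[where x=i]) (simp_all add: space_restrict_space)

text \<open>
  Independence of the labels makes a pair of distinct labels uniform on the square, which is what
  evaluating a Lebesgue measurable graphon at two labels requires.
\<close>

lemma distr_two_labels:
  fixes i j n :: nat
  assumes ij: "i < n" "j < n" "i \<noteq> j"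
  shows "distr (\<Pi>\<^sub>M i\<in>{..<n}. unit_leb) (unit_leb \<Otimes>\<^sub>M unit_leb) (\<lambda>l. (l i, l j)) = unit_leb \<Otimes>\<^sub>M unit_leb"
proof (rule pair_measure_eqI[symmetric])
  let ?M = "\<Pi>\<^sub>M i\<in>{..<n}. unit_leb"
  interpret PP: product_prob_space "\<lambda>_::nat. unit_leb" "{..<n}" by unfold_locales
  show "sigma_finite_measure unit_leb" "sigma_finite_measure unit_leb" by unfold_locales
  show "sets (unit_leb \<Otimes>\<^sub>M unit_leb) = sets (distr ?M (unit_leb \<Otimes>\<^sub>M unit_leb) (\<lambda>l. (l i, l j)))" by simp
  fix A B assume AB: "A \<in> sets unit_leb" "B \<in> sets unit_leb"
  have m: "(\<lambda>l. (l i, l j)) \<in> ?M \<rightarrow>\<^sub>M unit_leb \<Otimes>\<^sub>M unit_leb"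
    using ij by (intro measurable_Pair measurable_component_singleton) auto
  have "emeasure (distr ?M (unit_leb \<Otimes>\<^sub>M unit_leb) (\<lambda>l. (l i, l j))) (A \<times> B)
      = emeasure ?M {l \<in> space ?M. \<forall>m\<in>{i, j}. l m \<in> (if m = i then A else B)}"
    using AB ij(3) by (subst emeasure_distr[OF m]) (auto intro!: arg_cong[where f="emeasure ?M"])
  also have "\<dots> = (\<Prod>m\<in>{i, j}. emeasure unit_leb (if m = i then A else B))"
    using AB ij by (intro PP.emeasure_PiM_Collect) auto
  also have "\<dots> = emeasure unit_leb A * emeasure unit_leb B" using ij(3) by simp
  finally show "emeasure unit_leb A * emeasure unit_leb B
      = emeasure (distr ?M (unit_leb \<Otimes>\<^sub>M unit_leb) (\<lambda>l. (l i, l j))) (A \<times> B)" by simp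
qed

lemma measurable_graphon_labels:
  assumes W: "graphon W" and ij: "i < n" "j < n" "i \<noteq> j"
  shows "(\<lambda>l. W (l i) (l j)) \<in> borel_measurable (label_space n)"
proof -
  let ?M = "\<Pi>\<^sub>M i\<in>{..<n}. unit_leb" and ?T = "\<lambda>l. (l i, l j) :: real \<times> real"
  let ?P = "unit_leb \<Otimes>\<^sub>M unit_leb"
  have m: "?T \<in> ?M \<rightarrow>\<^sub>M ?P"
    using ij by (intro measurable_Pair measurable_component_singleton) auto
  have id: "(\<lambda>z. z) \<in> ?P \<rightarrow>\<^sub>M (borel :: (real\<times>real) measure)"
    by (rule measurable_unit_pair_borel)
  have T: "?T \<in> ?M \<rightarrow>\<^sub>M borel" using measurable_compose[OF m id] .
  have "distr ?M lborel ?T = distr ?P lborel (\<lambda>z. z)"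
    using distr_distr[OF _ m, of "\<lambda>z. z" lborel] id distr_two_labels[OF ij] by (simp add: comp_def)
  then have ac: "absolutely_continuous lborel (distr (completion ?M) lborel ?T)"
    using absolutely_continuous_pair T by (subst distr_completion) auto
  have T': "?T \<in> completion ?M \<rightarrow>\<^sub>M borel" using T by (rule measurable_completion)
  have "(\<lambda>l. W (fst (?T l)) (snd (?T l))) \<in> borel_measurable (completion ?M)"
  proof (rule graphon_compose_nonsingular[OF _ T' ac _ W])
    show "complete_measure (completion ?M)" ..
    show "?T l \<in> {0..1} \<times> {0..1}" if "l \<in> space (completion ?M)" for l
      using label_space_range[of l n] that ij by (simp add: label_space_def)
  qed
  then show ?thesis by (simp add: label_space_def)
qed

lemma expectation_given_labels:
  fixes F :: "graph \<Rightarrow> real"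
  assumes "graphon W" "l \<in> space (label_space n)"
  shows "measure_pmf.expectation (graph_given_labels n W l) F
       = (\<Sum>A\<in>Pow (node_pairs n). bernoulli_weight (node_pairs n) (\<lambda>(i, j). W (l i) (l j)) A * F (edges A))"
proof (rule expectation_graph_given_labels[where n=n and W=W and l=l and F=F])
  fix i j assume "(i, j) \<in> node_pairs n"
  then have "i < n" "j < n" by (simp_all add: node_pairs_def)
  then have "l i \<in> {0..1}" "l j \<in> {0..1}"
    using label_space_range[OF assms(2)] by blast+
  then show "0 \<le> W (l i) (l j) \<and> W (l i) (l j) \<le> 1"
    using assms(1) by (auto simp: graphon_def)
qed

lemma measurable_bernoulli_weight_labels:
  assumes W: "graphon W" and A: "A \<in> Pow (node_pairs n)"
  shows "(\<lambda>l. bernoulli_weight (node_pairs n) (\<lambda>(i, j). W (l i) (l j)) A) \<in> borel_measurable (label_space n)"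
proof -
  have m: "(\<lambda>l. case e of (i, j) \<Rightarrow> W (l i) (l j)) \<in> borel_measurable (label_space n)" if "e \<in> node_pairs n" for e
  proof -
    obtain i j where e: "e = (i, j)" by (cases e)
    with that have "i < n" "j < n" "i \<noteq> j" by (auto simp: node_pairs_def)
    from measurable_graphon_labels[OF W this] show ?thesis by (simp add: e)
  qed
  have "(\<lambda>l. \<Prod>e\<in>A. case e of (i, j) \<Rightarrow> W (l i) (l j)) \<in> borel_measurable (label_space n)"
    by (rule borel_measurable_prod, rule m) (use A in blast)
  moreover have "(\<lambda>l. \<Prod>e\<in>node_pairs n - A. 1 - (case e of (i, j) \<Rightarrow> W (l i) (l j))) \<in> borel_measurable (label_space n)"
    by (rule borel_measurable_prod, rule borel_measurable_diff[OF borel_measurable_const], rule m) blast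
  ultimately show ?thesis
    unfolding bernoulli_weight_def by (rule borel_measurable_times)
qed

lemma measurable_expectation_labels:
  fixes F :: "graph \<Rightarrow> real"
  assumes W: "graphon W"
  shows "(\<lambda>l. measure_pmf.expectation (graph_given_labels n W l) F) \<in> borel_measurable (label_space n)"
proof -
  have "(\<lambda>l. \<Sum>A\<in>Pow (node_pairs n). bernoulli_weight (node_pairs n) (\<lambda>(i, j). W (l i) (l j)) A * F (edges A))
      \<in> borel_measurable (label_space n)"
    by (rule borel_measurable_sum, rule borel_measurable_times,
        rule measurable_bernoulli_weight_labels[OF W], assumption, rule borel_measurable_const)
  then show ?thesis
    using measurable_cong[OF expectation_given_labels[OF W, of _ n F], of "label_space n" "\<lambda>l. l" borel] by simp
qed

lemma measurable_graph_given_labels: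
  assumes W: "graphon W"
  shows "(\<lambda>l. measure_pmf (graph_given_labels n W l)) \<in> label_space n \<rightarrow>\<^sub>M subprob_algebra (count_space UNIV)"
proof (rule measurable_subprob_algebra)
  fix A :: "graph set"
  have "emeasure (measure_pmf p) A = ennreal (measure_pmf.expectation p (indicator A))" for p :: "graph pmf"
    by (simp add: measure_pmf.emeasure_eq_measure)
  then show "(\<lambda>l. emeasure (measure_pmf (graph_given_labels n W l)) A) \<in> borel_measurable (label_space n)"
    using measurable_expectation_labels[OF W, of n "indicator A"] by simp
qed (auto intro: prob_space_imp_subprob_space measure_pmf.prob_space_axioms)

lemma set_graph_given_labels: "set_pmf (graph_given_labels n W l) \<subseteq> graphs n"
proof -
  have "{{i, j} |i j. (i, j) \<in> node_pairs n \<and> b (i, j)} \<in> graphs n" for b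
    by (force simp: graphs_def node_pairs_def)
  then show ?thesis by (auto simp: graph_given_labels_def)
qed

lemma finite_graphs: "finite (graphs n)"
  unfolding graphs_def by (rule finite_Pow_iff[THEN iffD2], rule finite_subset[of _ "Pow {..<n}"]) auto

text \<open>
  Although graphs form an infinite type here, the random graph lives on the finite set \<open>graphs n\<close>.
  An estimator is arbitrary elsewhere, so the integrand is cut off before it is integrated.
\<close>

lemma integral_random_graph:
  fixes F :: "graph \<Rightarrow> real"
  assumes W: "graphon W"
  shows "(LINT G|random_graph n W. F G)
       = (LINT l|label_space n. measure_pmf.expectation (graph_given_labels n W l) F)"
proof -
  interpret L: prob_space "label_space n" by (rule prob_space_label_space)
  let ?N = "\<lambda>l. measure_pmf (graph_given_labels n W l)"
  let ?F = "\<lambda>G. if G \<in> graphs n then F G else 0"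
  note N = measurable_graph_given_labels[OF W, of n]
  have sets: "sets (random_graph n W) = UNIV"
    unfolding random_graph_def using sets_bind[OF sets_kernel[OF N] L.not_empty] by simp
  have "AE G in random_graph n W. G \<in> graphs n"
    unfolding random_graph_def
    by (subst AE_bind[OF N]) (simp_all add: AE_measure_pmf_iff subsetD[OF set_graph_given_labels])
  then have "(LINT G|random_graph n W. F G) = (LINT G|random_graph n W. ?F G)"
    by (intro integral_cong_AE) (auto simp: measurable_def sets elim: eventually_mono)
  also have "\<dots> = (LINT l|label_space n. measure_pmf.expectation (graph_given_labels n W l) ?F)"
    unfolding random_graph_def
  proof (rule integral_bind[where K="count_space UNIV" and B="\<Sum>G\<in>graphs n. \<bar>F G\<bar>" and B'=1])
    show "\<bar>?F G\<bar> \<le> (\<Sum>G\<in>graphs n. \<bar>F G\<bar>)" for G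
      using member_le_sum[of G "graphs n" "\<lambda>G. \<bar>F G\<bar>"] finite_graphs[of n] by (auto intro: sum_nonneg)
    show "finite_measure (label_space n)" by (rule L.finite_measure_axioms)
    show "AE l in label_space n. emeasure (?N l) (space (?N l)) \<le> ennreal 1"
      by (simp add: measure_pmf.emeasure_space_1 del: space_measure_pmf)
  qed (use N in simp_all)
  also have "\<dots> = (LINT l|label_space n. measure_pmf.expectation (graph_given_labels n W l) F)"
  proof (rule Bochner_Integration.integral_cong[OF refl])
    fix l
    show "measure_pmf.expectation (graph_given_labels n W l) ?F = measure_pmf.expectation (graph_given_labels n W l) F"
      using set_graph_given_labels[of n W l] by (intro integral_cong_AE) (auto simp: AE_measure_pmf_iff)
  qed
  finally show ?thesis .
qed

lemma delta2_nonneg: "0 \<le> delta2 V W"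
  unfolding delta2_def using identity_measure_preserving l2_norm_nonneg by (intro cINF_greatest) auto

text \<open>
  This bound makes the set of risks bounded above, so that their supremum is a genuine one.
\<close>

lemma delta2_le_1:
  assumes "graphon V" "graphon W"
  shows "delta2 V W \<le> 1"
proof -
  let ?D = "\<lambda>z. V (fst z) (snd z) - W (fst z) (snd z)"
  have "delta2 V W \<le> l2_norm (\<lambda>x y. pullback V (\<lambda>x. x) x y - W x y)"
    unfolding delta2_def using identity_measure_preserving l2_norm_nonneg
    by (intro cINF_lower bdd_belowI2[where m=0]) auto
  also have "\<dots> = sqrt (LINT z|square_leb. (?D z)\<^sup>2)"
    by (simp add: l2_norm_def pullback_def split_beta')
  also have "\<dots> \<le> sqrt 1"
  proof (rule real_sqrt_le_mono)
    interpret sq: prob_space square_leb by (rule prob_space_square_leb)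
    have "(?D z)\<^sup>2 \<le> 1" if "z \<in> space square_leb" for z
    proof -
      have "\<bar>?D z\<bar> \<le> 1"
        by (rule graphon_diff_le_1[OF assms]) (use that in \<open>auto simp: space_restrict_space\<close>)
      then show ?thesis by (simp add: abs_square_le_1)
    qed
    then have AE: "AE z in square_leb. (?D z)\<^sup>2 \<le> 1" by (intro AE_I2)
    show "(LINT z|square_leb. (?D z)\<^sup>2) \<le> 1"
    proof (cases "integrable square_leb (\<lambda>z. (?D z)\<^sup>2)")
      case True
      then show ?thesis using AE by (rule sq.integral_le_const)
    qed (simp add: not_integrable_integral_eq)
  qed
  finally show ?thesis by simp
qed

section \<open>The minimax lower bound\<close>

lemma graphon_pattern:
  assumes k: "1 \<le> k" and \<rho>: "0 < \<rho>" "\<rho> \<le> 1" and \<epsilon>: "0 \<le> \<epsilon>" "\<epsilon> \<le> \<rho> / 2" and s: "\<And>a b. s a b = s b a"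
  shows "bounded_graphon \<rho> (pattern_graphon (\<rho> / 2) \<epsilon> k s)" "block_graphon k (pattern_graphon (\<rho> / 2) \<epsilon> k s)"
proof -
  let ?W = "pattern_graphon (\<rho> / 2) \<epsilon> k s"
  let ?I = "\<lambda>a. {x \<in> {0..1}. block_index k x = a}"
  have val: "0 \<le> ?W x y \<and> ?W x y \<le> \<rho>" for x y
    using \<epsilon> \<rho> by (simp add: pattern_graphon_def level_def)
  have meas: "case_prod ?W \<in> borel_measurable square_leb"
    using measurable_pattern_graphon by (intro measurable_restrict_space1 measurable_completion) simp
  have sym: "?W x y = ?W y x" for x y
    by (simp add: pattern_graphon_def level_def s[of "block_index k x"])
  have G: "graphon ?W"
    unfolding graphon_def
  proof (intro conjI ballI)
    show "case_prod ?W \<in> borel_measurable square_leb" by (rule meas)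
    fix x y :: real
    show "?W x y = ?W y x" by (rule sym)
    show "0 \<le> ?W x y" "?W x y \<le> 1" using val[of x y] \<rho> by linarith+
  qed
  then show "bounded_graphon \<rho> ?W"
    unfolding bounded_graphon_def using val by blast
  have k0: "0 < k" using k by simp
  have ne: "?I a \<noteq> {}" if "a < k" for a
  proof
    assume "?I a = {}"
    then have "ennreal (1 / real k) = 0" using emeasure_block[OF that] by (simp only: emeasure_empty)
    then show False using k0 by (simp add: ennreal_eq_0_iff)
  qed
  have inj: "inj_on ?I {..<k}"
  proof (rule inj_onI)
    fix a b assume "a \<in> {..<k}" "b \<in> {..<k}" and eq: "?I a = ?I b"
    then obtain x where "x \<in> ?I a" using ne by blast
    then have "x \<in> ?I b" "block_index k x = a" using eq by auto
    then show "a = b" by simp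
  qed
  have "partition_on {0..1} (?I ` {..<k})"
    unfolding partition_on_def
  proof (intro conjI)
    show "\<Union> (?I ` {..<k}) = {0..1}" using block_index_less[OF k0] by auto
    show "disjoint (?I ` {..<k})" by (auto simp: disjoint_def)
    show "{} \<notin> ?I ` {..<k}" using ne by (metis (no_types, lifting) imageE lessThan_iff)
  qed
  moreover have "?I ` {..<k} \<subseteq> sets lebesgue"
  proof
    fix X assume "X \<in> ?I ` {..<k}"
    then obtain a where "X = ?I a" by blast
    moreover have "?I a \<in> sets borel" by measurable
    ultimately show "X \<in> sets lebesgue" by simp
  qed
  moreover have "\<forall>I\<in>?I ` {..<k}. \<forall>J\<in>?I ` {..<k}. \<exists>c. \<forall>x\<in>I. \<forall>y\<in>J. ?W x y = c"
    unfolding pattern_graphon_def by auto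
  moreover have "card (?I ` {..<k}) = k" using card_image[OF inj] by simp
  moreover have "finite (?I ` {..<k})" by simp
  ultimately show "block_graphon k ?W" unfolding block_graphon_def using G by blast
qed

definition risk :: "nat \<Rightarrow> (graph \<Rightarrow> kernel) \<Rightarrow> kernel \<Rightarrow> real" where
  "risk n What W = (LINT G|random_graph n W. delta2 (What G) W)"

text \<open>
  Conditionally on the labels the random graph has finitely many values, and the risk is a finite
  sum.
\<close>

lemma conditional_risk_bounds:
  assumes What: "What \<in> estimators n" and W: "graphon W" and l: "l \<in> space (label_space n)"
  shows "0 \<le> measure_pmf.expectation (graph_given_labels n W l) (\<lambda>G. delta2 (What G) W)"
    and "measure_pmf.expectation (graph_given_labels n W l) (\<lambda>G. delta2 (What G) W) \<le> 1"
proof -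
  let ?E = "node_pairs n" and ?q = "\<lambda>(i, j). W (l i) (l j)"
  have q01: "0 \<le> ?q e \<and> ?q e \<le> 1" if e: "e \<in> ?E" for e
  proof -
    obtain i j where ij: "e = (i, j)" by (cases e)
    with e have "i < n" "j < n" by (simp_all add: node_pairs_def)
    then have "l i \<in> {0..1}" "l j \<in> {0..1}" using label_space_range[OF l] by blast+
    then show ?thesis using W by (simp add: ij graphon_def)
  qed
  have P: "0 \<le> bernoulli_weight ?E ?q A" if "A \<in> Pow ?E" for A
    using bernoulli_weight_nonneg[of ?E ?q A] q01 that by blast
  have d: "delta2 (What (edges A)) W \<le> 1" if "A \<in> Pow ?E" for A
    using What that W edges_in_graphs[of A n] by (intro delta2_le_1) (auto simp: estimators_def)
  show "0 \<le> measure_pmf.expectation (graph_given_labels n W l) (\<lambda>G. delta2 (What G) W)"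
    by (intro integral_nonneg_AE AE_I2 delta2_nonneg)
  have "measure_pmf.expectation (graph_given_labels n W l) (\<lambda>G. delta2 (What G) W)
      \<le> (\<Sum>A\<in>Pow ?E. bernoulli_weight ?E ?q A * 1)"
    unfolding expectation_given_labels[OF W l]
    by (intro sum_mono mult_left_mono d P)
  also have "\<dots> = 1" using sum_bernoulli_weight[OF finite_node_pairs, of n ?q] by simp
  finally show "measure_pmf.expectation (graph_given_labels n W l) (\<lambda>G. delta2 (What G) W) \<le> 1" .
qed

lemma integrable_conditional_risk:
  assumes What: "What \<in> estimators n" and W: "graphon W"
  shows "integrable (label_space n) (\<lambda>l. measure_pmf.expectation (graph_given_labels n W l) (\<lambda>G. delta2 (What G) W))"
proof -
  interpret L: prob_space "label_space n" by (rule prob_space_label_space)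
  show ?thesis
  proof (rule L.integrable_const_bound[where B=1])
    show "AE l in label_space n. norm (measure_pmf.expectation (graph_given_labels n W l) (\<lambda>G. delta2 (What G) W)) \<le> 1"
    proof (rule AE_I2)
      fix l assume "l \<in> space (label_space n)"
      from conditional_risk_bounds[OF What W this]
      show "norm (measure_pmf.expectation (graph_given_labels n W l) (\<lambda>G. delta2 (What G) W)) \<le> 1" by simp
    qed
  qed (rule measurable_expectation_labels[OF W])
qed

lemma risk_le_1:
  assumes What: "What \<in> estimators n" and W: "graphon W"
  shows "risk n What W \<le> 1"
proof -
  interpret L: prob_space "label_space n" by (rule prob_space_label_space)
  show ?thesis
    unfolding risk_def integral_random_graph[OF W]
    by (intro L.integral_le_const integrable_conditional_risk[OF What W] AE_I2 conditional_risk_bounds(2)[OF What W])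
qed

text \<open>
  For each graph, all patterns within \<open>\<epsilon> / 4\<close> of the estimate nearly match any one of them, so they
  form at most a fraction \<open>\<beta>\<close> of a separated family. Conditionally on the labels, edge
  probabilities stay within \<open>\<epsilon>\<close> of \<open>p\<close>, and the identification bound applies with a constant that
  does not depend on the labels; it therefore survives averaging over them.
\<close>

lemma total_risk_lower_bound:
  assumes What: "What \<in> estimators n" and k: "1 \<le> k" and p: "0 < p" "p < 1" and \<epsilon>: "0 < \<epsilon>"
    and S: "separated_family k \<beta> S"
    and W: "\<And>s. s \<in> S \<Longrightarrow> graphon (pattern_graphon p \<epsilon> k s)"
  shows "real (card S) * (\<epsilon> / 4 * (1 - sqrt (\<beta> * exp (real (card (node_pairs n)) * (\<epsilon>\<^sup>2 / (p * (1 - p)))))))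
       \<le> (\<Sum>s\<in>S. risk n What (pattern_graphon p \<epsilon> k s))"
proof -
  interpret L: prob_space "label_space n" by (rule prob_space_label_space)
  let ?W = "pattern_graphon p \<epsilon> k" and ?E = "node_pairs n"
  let ?r = "sqrt (\<beta> * exp (real (card ?E) * (\<epsilon>\<^sup>2 / (p * (1 - p)))))"
  let ?f = "\<lambda>s l. measure_pmf.expectation (graph_given_labels n (?W s) l) (\<lambda>G. delta2 (What G) (?W s))"
  define N where "N A s \<longleftrightarrow> delta2 (What (edges A)) (?W s) < \<epsilon> / 4" for A s
  have finS: "finite S" using S by (simp add: separated_family_def)
  have \<beta>: "0 \<le> \<beta> * real (card S)"
  proof -
    obtain s' where "s' \<in> S" using S by (auto simp: separated_family_def)
    then have "real (card {s \<in> S. nearly_matches k s s'}) \<le> \<beta> * real (card S)"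
      using S unfolding separated_family_def by blast
    then show ?thesis by (rule order_trans[OF of_nat_0_le_iff])
  qed
  have near: "real (card {s \<in> S. N A s}) \<le> \<beta> * real (card S)" if A: "A \<subseteq> ?E" for A
  proof (cases "\<exists>s'\<in>S. N A s'")
    case True
    then obtain s' where s': "s' \<in> S" "N A s'" by blast
    have V: "graphon (What (edges A))"
      using What edges_in_graphs[OF A] by (auto simp: estimators_def)
    have "{s \<in> S. N A s} \<subseteq> {s \<in> S. nearly_matches k s s'}"
    proof safe
      fix s assume s: "s \<in> S" "N A s"
      show "nearly_matches k s s'"
        by (rule delta2_near_both_imp_nearly_matches[OF V k \<epsilon> W[OF s(1)] W[OF s'(1)]
              s(2)[unfolded N_def] s'(2)[unfolded N_def]])
    qed
    then have "card {s \<in> S. N A s} \<le> card {s \<in> S. nearly_matches k s s'}"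
      using finS by (intro card_mono) auto
    then have "real (card {s \<in> S. N A s}) \<le> real (card {s \<in> S. nearly_matches k s s'})" by simp
    also have "\<dots> \<le> \<beta> * real (card S)" using S s'(1) unfolding separated_family_def by blast
    finally show ?thesis .
  next
    case False
    then have "{s \<in> S. N A s} = {}" by blast
    then show ?thesis using \<beta> by (simp only: card.empty of_nat_0)
  qed
  have cond: "real (card S) * (\<epsilon> / 4 * (1 - ?r)) \<le> (\<Sum>s\<in>S. ?f s l)" if l: "l \<in> space (label_space n)" for l
  proof -
    define q where "q s = (\<lambda>(i, j). ?W s (l i) (l j))" for s
    have dev: "\<bar>q s e - p\<bar> \<le> \<epsilon>" for s e
      using \<epsilon> by (simp add: q_def split_beta pattern_graphon_def level_def)
    have q01: "0 \<le> q s e \<and> q s e \<le> 1" if s: "s \<in> S" and e: "e \<in> ?E" for s e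
    proof -
      obtain i j where ij: "e = (i, j)" by (cases e)
      with e have "i < n" "j < n" by (simp_all add: node_pairs_def)
      then have "l i \<in> {0..1}" "l j \<in> {0..1}" using label_space_range[OF l] by blast+
      then show ?thesis using W[OF s] by (simp add: ij q_def graphon_def)
    qed
    have "\<epsilon> / 4 * (1 - (\<Sum>A | A \<in> Pow ?E \<and> N A s. bernoulli_weight ?E (q s) A)) \<le> ?f s l" if s: "s \<in> S" for s
    proof -
      have "\<epsilon> / 4 * (1 - (\<Sum>A | A \<in> Pow ?E \<and> N A s. bernoulli_weight ?E (q s) A))
          = \<epsilon> / 4 * ((\<Sum>A\<in>Pow ?E. bernoulli_weight ?E (q s) A) - (\<Sum>A\<in>Pow ?E. if N A s then bernoulli_weight ?E (q s) A else 0))"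
        using finite_node_pairs[of n] by (simp add: sum_bernoulli_weight sum.inter_filter[symmetric])
      also have "\<dots> = (\<Sum>A\<in>Pow ?E. \<epsilon> / 4 * (bernoulli_weight ?E (q s) A - (if N A s then bernoulli_weight ?E (q s) A else 0)))"
        by (simp only: sum_distrib_left[symmetric] sum_subtractf)
      also have "\<dots> \<le> (\<Sum>A\<in>Pow ?E. bernoulli_weight ?E (q s) A * delta2 (What (edges A)) (?W s))"
      proof (rule sum_mono)
        fix A assume A: "A \<in> Pow ?E"
        have P: "0 \<le> bernoulli_weight ?E (q s) A"
          using bernoulli_weight_nonneg[of ?E "q s" A] q01[OF s] A by blast
        show "\<epsilon> / 4 * (bernoulli_weight ?E (q s) A - (if N A s then bernoulli_weight ?E (q s) A else 0))
            \<le> bernoulli_weight ?E (q s) A * delta2 (What (edges A)) (?W s)"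
        proof (cases "N A s")
          case True
          then show ?thesis using P delta2_nonneg by simp
        next
          case False
          then have "\<epsilon> / 4 \<le> delta2 (What (edges A)) (?W s)" by (simp add: N_def)
          from mult_left_mono[OF this P] show ?thesis using False by (simp add: mult.commute)
        qed
      qed
      also have "\<dots> = ?f s l"
        unfolding expectation_given_labels[OF W[OF s] l] q_def ..
      finally show ?thesis .
    qed
    then have "(\<Sum>s\<in>S. \<epsilon> / 4 * (1 - (\<Sum>A | A \<in> Pow ?E \<and> N A s. bernoulli_weight ?E (q s) A))) \<le> (\<Sum>s\<in>S. ?f s l)"
      by (rule sum_mono)
    moreover have "(\<Sum>s\<in>S. \<epsilon> / 4 * (1 - (\<Sum>A | A \<in> Pow ?E \<and> N A s. bernoulli_weight ?E (q s) A)))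
        = \<epsilon> / 4 * (real (card S) - (\<Sum>s\<in>S. \<Sum>A | A \<in> Pow ?E \<and> N A s. bernoulli_weight ?E (q s) A))"
      unfolding sum_distrib_left[symmetric] sum_subtractf by simp
    moreover have "\<dots> \<ge> \<epsilon> / 4 * (real (card S) - real (card S) * ?r)"
      using identification_probability_bound[where E="?E" and S=S and N=N and q=q, OF finite_node_pairs finS p dev near] \<epsilon>
      by (intro mult_left_mono diff_left_mono) auto
    ultimately show ?thesis by (simp add: algebra_simps)
  qed
  have "real (card S) * (\<epsilon> / 4 * (1 - ?r)) \<le> (LINT l|label_space n. (\<Sum>s\<in>S. ?f s l))"
    by (intro L.integral_ge_const Bochner_Integration.integrable_sum integrable_conditional_risk[OF What W] AE_I2 cond)
  also have "\<dots> = (\<Sum>s\<in>S. (LINT l|label_space n. ?f s l))"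
    by (intro Bochner_Integration.integral_sum integrable_conditional_risk[OF What W])
  also have "\<dots> = (\<Sum>s\<in>S. risk n What (?W s))"
    by (intro sum.cong refl) (simp add: risk_def integral_random_graph[OF W])
  finally show ?thesis .
qed

lemma graphon_zero: "graphon (\<lambda>_ _. 0)"
  by (simp add: graphon_def split_beta')

theorem theorem10:
  "\<exists>c>0. \<forall>(k::nat) (n::nat) (\<rho>::real).
     1 \<le> k \<and> k \<le> n \<and> 0 < \<rho> \<and> \<rho> \<le> 1 \<longrightarrow>
       (INF What\<in>estimators n.
          SUP W\<in>{W. block_graphon k W \<and> bounded_graphon \<rho> W}.
            (LINT G|random_graph n W. delta2 (What G) W))
       \<ge> c * min \<rho> (sqrt (\<rho> * (real k)\<^sup>2 / (real n)\<^sup>2))"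
proof -
  obtain \<kappa> where \<kappa>: "\<kappa> > 0" and fam: "\<And>k. k \<ge> 1 \<Longrightarrow> \<exists>S. separated_family k (2/3 * exp (- \<kappa> * (real k)\<^sup>2)) S"
    using separated_patterns by blast
  \<comment> \<open>The second constraint keeps the chi-square exponent \<open>2 * d\<^sup>2 * k\<^sup>2\<close> below \<open>\<kappa> * k\<^sup>2\<close>, the first one
    keeps the edge probabilities \<open>\<rho> / 2 \<plusminus> \<epsilon>\<close> between zero and \<open>\<rho>\<close>.\<close>
  define d where "d = min (1/4) (sqrt (\<kappa> / 2))"
  have d: "0 < d" "d \<le> 1/4" "d\<^sup>2 \<le> \<kappa> / 2"
  proof -
    show "0 < d" "d \<le> 1/4" using \<kappa> by (auto simp: d_def)
    then have "d\<^sup>2 \<le> (sqrt (\<kappa> / 2))\<^sup>2" by (intro power_mono) (auto simp: d_def)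
    then show "d\<^sup>2 \<le> \<kappa> / 2" using \<kappa> by simp
  qed
  define c where "c = d / 4 * (1 - sqrt (2/3))"
  have "sqrt (2/3) < sqrt 1" by (rule real_sqrt_less_mono) simp
  then have c: "c > 0" using d by (simp add: c_def)
  have main: "c * min \<rho> (sqrt (\<rho> * (real k)\<^sup>2 / (real n)\<^sup>2))
      \<le> (INF What\<in>estimators n. SUP W\<in>{W. block_graphon k W \<and> bounded_graphon \<rho> W}. risk n What W)"
    if k: "1 \<le> k" and kn: "k \<le> n" and \<rho>: "0 < \<rho>" "\<rho> \<le> 1" for k n :: nat and \<rho> :: real
  proof (rule cINF_greatest)
    have "(\<lambda>_. (\<lambda>_ _. 0)) \<in> estimators n" using graphon_zero by (simp add: estimators_def)
    then show "estimators n \<noteq> {}" by blast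
    fix What assume What: "What \<in> estimators n"
    define rate where "rate = min \<rho> (sqrt (\<rho> * (real k)\<^sup>2 / (real n)\<^sup>2))"
    define \<epsilon> where "\<epsilon> = d * rate"
    have n: "0 < real n" "0 < real k" using k kn by auto
    have rate: "0 < rate" "rate \<le> \<rho>" "rate\<^sup>2 \<le> \<rho> * (real k)\<^sup>2 / (real n)\<^sup>2"
    proof -
      show "0 < rate" "rate \<le> \<rho>" using n \<rho> by (auto simp: rate_def)
      then have "rate\<^sup>2 \<le> (sqrt (\<rho> * (real k)\<^sup>2 / (real n)\<^sup>2))\<^sup>2" by (intro power_mono) (auto simp: rate_def)
      then show "rate\<^sup>2 \<le> \<rho> * (real k)\<^sup>2 / (real n)\<^sup>2" using \<rho> by simp
    qed
    have \<epsilon>0: "0 < \<epsilon>" using d rate by (simp add: \<epsilon>_def)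
    have "\<epsilon> \<le> 1/4 * \<rho>" unfolding \<epsilon>_def using d rate by (intro mult_mono) auto
    then have \<epsilon>\<rho>: "\<epsilon> \<le> \<rho> / 2" using \<rho> by simp
    have "real (card (node_pairs n)) * (\<epsilon>\<^sup>2 / (\<rho> / 2 * (1 - \<rho> / 2))) \<le> (real n)\<^sup>2 / 2 * (\<epsilon>\<^sup>2 / (\<rho> / 4))"
    proof (intro mult_mono divide_left_mono)
      have "real (2 * card (node_pairs n)) \<le> real (n\<^sup>2)" using card_node_pairs_le by (rule of_nat_mono)
      then show "real (card (node_pairs n)) \<le> (real n)\<^sup>2 / 2" by simp
      have "\<rho> / 2 * (1/2) \<le> \<rho> / 2 * (1 - \<rho> / 2)" using \<rho> by (intro mult_left_mono) auto
      then show "\<rho> / 4 \<le> \<rho> / 2 * (1 - \<rho> / 2)" by simp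
    qed (use \<rho> in auto)
    also have "\<dots> = 2 * (real n)\<^sup>2 * d\<^sup>2 * rate\<^sup>2 / \<rho>"
      using \<rho> by (simp add: \<epsilon>_def power_mult_distrib field_simps)
    also have "\<dots> \<le> 2 * (real n)\<^sup>2 * (\<kappa> / 2) * (\<rho> * (real k)\<^sup>2 / (real n)\<^sup>2) / \<rho>"
      using \<rho> d rate \<kappa> by (intro divide_right_mono mult_mono) auto
    also have "\<dots> = \<kappa> * (real k)\<^sup>2" using n \<rho> by simp
    finally have \<chi>: "real (card (node_pairs n)) * (\<epsilon>\<^sup>2 / (\<rho> / 2 * (1 - \<rho> / 2))) \<le> \<kappa> * (real k)\<^sup>2" .
    obtain S where S: "separated_family k (2/3 * exp (- \<kappa> * (real k)\<^sup>2)) S" using fam[OF k] by blast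
    have finS: "finite S" "S \<noteq> {}" and symS: "\<And>s a b. s \<in> S \<Longrightarrow> s a b = s b a"
      using S by (auto simp: separated_family_def)
    let ?W = "pattern_graphon (\<rho> / 2) \<epsilon> k"
    have W: "bounded_graphon \<rho> (?W s)" "block_graphon k (?W s)" if "s \<in> S" for s
      using graphon_pattern[where s=s, OF k \<rho> less_imp_le[OF \<epsilon>0] \<epsilon>\<rho> symS[OF that]] by blast+
    have Wg: "graphon (?W s)" if "s \<in> S" for s using W(1)[OF that] by (simp add: bounded_graphon_def)
    let ?r = "sqrt (2/3 * exp (- \<kappa> * (real k)\<^sup>2) * exp (real (card (node_pairs n)) * (\<epsilon>\<^sup>2 / (\<rho> / 2 * (1 - \<rho> / 2)))))"
    have "?r \<le> sqrt (2/3)"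
    proof (rule real_sqrt_le_mono)
      have "exp (- \<kappa> * (real k)\<^sup>2) * exp (real (card (node_pairs n)) * (\<epsilon>\<^sup>2 / (\<rho> / 2 * (1 - \<rho> / 2)))) \<le> 1"
        unfolding exp_add[symmetric] using \<chi> by simp
      then show "2/3 * exp (- \<kappa> * (real k)\<^sup>2) * exp (real (card (node_pairs n)) * (\<epsilon>\<^sup>2 / (\<rho> / 2 * (1 - \<rho> / 2)))) \<le> 2/3"
        by simp
    qed
    then have "c * rate \<le> \<epsilon> / 4 * (1 - ?r)"
      using \<epsilon>0 mult_left_mono[of "1 - sqrt (2/3)" "1 - ?r" "\<epsilon> / 4"] by (simp add: c_def \<epsilon>_def algebra_simps)
    then have "real (card S) * (c * rate) \<le> real (card S) * (\<epsilon> / 4 * (1 - ?r))"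
      by (rule mult_left_mono) simp
    also have "\<dots> \<le> (\<Sum>s\<in>S. risk n What (?W s))"
      by (rule total_risk_lower_bound[OF What k _ _ \<epsilon>0 S Wg]) (use \<rho> in auto)
    finally have "(\<Sum>s\<in>S. c * rate) \<le> (\<Sum>s\<in>S. risk n What (?W s))" by simp
    then obtain s where s: "s \<in> S" "c * rate \<le> risk n What (?W s)"
      using sum_strict_mono[OF finS, of "\<lambda>s. risk n What (?W s)" "\<lambda>_. c * rate"] by (meson not_le)
    have "bdd_above (risk n What ` {W. block_graphon k W \<and> bounded_graphon \<rho> W})"
      by (rule bdd_aboveI2[where M=1]) (auto intro!: risk_le_1[OF What] simp: block_graphon_def)
    then have "risk n What (?W s) \<le> (SUP W\<in>{W. block_graphon k W \<and> bounded_graphon \<rho> W}. risk n What W)"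
      using W[OF s(1)] by (intro cSUP_upper) auto
    with s(2) show "c * min \<rho> (sqrt (\<rho> * (real k)\<^sup>2 / (real n)\<^sup>2))
        \<le> (SUP W\<in>{W. block_graphon k W \<and> bounded_graphon \<rho> W}. risk n What W)"
      unfolding rate_def by (rule order_trans)
  qed
  show ?thesis
    using c main unfolding risk_def by blast
qed

end
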